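(* Let $n\ge3$ and $3\le m\le n$. Given the primitive $(2(m-1)-1)$-cocycle $\Omega^{(2[m-1]-1)}$ of $su(n)$, the coordinates of the next primitive cocycle, $\Omega^{(2m-1)}$, are obtained from it by the formula $$\Omega^{(2m-1)}_{i_1\dots i_{2m-1}}=\frac{1}{(2m-1)!}\,\epsilon^{j_1\dots j_{2m-1}}_{i_1\dots i_{2m-1}}\,\Omega^{(2[m-1]-1)}_{j_1\dots j_{2m-4}}{}^{s}\;C^{l}_{j_{2m-3}j_{2m-2}}\,d_{s\,l\,j_{2m-1}} .$$
   Context: The $su(n)$ generators $T_i$, $i=1,\dots,n^2-1$, are the hermitian traceless $n\times n$ matrices of the defining representation with $\mathrm{Tr}(T_iT_j)=\frac12\delta_{ij}$, $[T_i,T_j]=i f_{ij}{}^kT_k$, $\{T_i,T_j\}=\frac1n\delta_{ij}+d_{ij}{}^kT_k$. The antihermitian generators $X_i=-iT_i$ satisfy $[X_i,X_j]=C_{ij}^kX_k$ with $C_{ijk}=f_{ijk}$. Indices are raised and lowered with $\delta_{ij}$; repeated indices are summed. The $d$-tensors are $d^{(2)}_{ij}=\delta_{ij}$, $d^{(3)}_{ijk}=d_{ijk}$, and recursively $d^{(r+1)}_{i_1\dots i_{r+1}}=d^{(r)}_{i_1\dots i_{r-1}}{}^{j}\,d_{j i_ri_{r+1}}$, $r\ge3$; the corresponding symmetric invariant tensors are their unit-weight symmetrisations $d^{(r)}_{(i_1\dots i_r)}$. With $\epsilon_{\alpha_1\dots\alpha_N}^{\beta_1\dots\beta_N}=\sum_{\sigma\in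 S_N}\mathrm{sgn}(\sigma)\,\delta_{\alpha_1}^{\beta_{\sigma(1)}}\cdots\delta_{\alpha_N}^{\beta_{\sigma(N)}}$, the primitive cocycles are defined here by means of the $d$-family: $$\Omega^{(2m-1)}_{i_1\dots i_{2m-1}}=\frac{1}{(2m-1)!}\,\epsilon^{j_1\dots j_{2m-1}}_{i_1\dots i_{2m-1}}\,C_{j_1j_2}^{l_1}\cdots C_{j_{2m-3}j_{2m-2}}^{l_{m-1}}\,d^{(m)}_{(l_1\dots l_{m-1}j_{2m-1})},\qquad 2\le m\le n;$$ in particular $\Omega^{(3)}_{ijk}=C_{ijk}$. *)

theory Defs
  imports "HOL-Analysis.Analysis"
begin

section \<open>Generators of su(n)\<close>

definition cscale :: "complex \<Rightarrow> complex^'n^'m \<Rightarrow> complex^'n^'m"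
  where "cscale c A = (\<chi> a b. c * A $ a $ b)"

definition hermitian :: "complex^'n^'n \<Rightarrow> bool"
  where "hermitian A \<longleftrightarrow> (\<forall>a b. A $ a $ b = cnj (A $ b $ a))"

definition antiherm :: "('g \<Rightarrow> complex^'n^'n) \<Rightarrow> 'g \<Rightarrow> complex^'n^'n"
  where "antiherm T i = cscale (- \<i>) (T i)"

text \<open>
  The index type \<open>'g\<close> stands for the adjoint index range \<open>1, \<dots>, n\<^sup>2 - 1\<close>, where
  \<open>n = CARD('n)\<close>; trace orthonormality and the number of generators make \<open>T\<close> a basis of the
  hermitian traceless matrices. As indices are raised and lowered with the Kronecker delta, upper
  and lower positions are not distinguished: \<open>f i j k\<close>, \<open>d i j k\<close> and \<open>C i j k\<close> are the paper's
  tensors with \<open>k\<close> raised. \<open>C\<close> holds the structure constants of the antihermitian basis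
  \<open>X\<^sub>i = - \<i> T\<^sub>i\<close>; that \<open>C = f\<close> is proved below.
\<close>

locale su_generators =
  fixes T :: "'g::finite \<Rightarrow> complex^'n^'n"
    and f d C :: "'g \<Rightarrow> 'g \<Rightarrow> 'g \<Rightarrow> real"
  assumes card_generators: "CARD('g) = CARD('n)\<^sup>2 - 1"
    and hermitian_T: "hermitian (T i)"
    and traceless_T: "trace (T i) = 0"
    and trace_T_T: "trace (T i ** T j) = (if i = j then 1 / 2 else 0)"
    and commutator_T:
      "T i ** T j - T j ** T i = cscale \<i> (\<Sum>k\<in>UNIV. f i j k *\<^sub>R T k)"
    and anticommutator_T:
      "T i ** T j + T j ** T i =
         (if i = j then mat (1 / of_nat CARD('n)) else 0) + (\<Sum>k\<in>UNIV. d i j k *\<^sub>R T k)"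
    and commutator_X:
      "antiherm T i ** antiherm T j - antiherm T j ** antiherm T i =
         (\<Sum>k\<in>UNIV. C i j k *\<^sub>R antiherm T k)"

lemma (in su_generators) C_eq_f: "C i j k = f i j k"
proof -
  have m: "antiherm T i ** antiherm T j = - (T i ** T j)" for i j
  proof -
    have "- \<i> * x * (- \<i> * y) = - (x * y)" for x y :: complex
      by (metis i_squared mult.assoc mult.left_commute mult_minus1 minus_mult_minus)
    then show ?thesis
      by (simp only: vec_eq_iff antiherm_def cscale_def matrix_matrix_mult_def vec_lambda_beta
          uminus_vec_def sum_negf simp_thms)
  qed
  have "cscale (- \<i>) (\<Sum>k\<in>UNIV. C i j k *\<^sub>R T k) = (\<Sum>k\<in>UNIV. C i j k *\<^sub>R antiherm T k)"
    by (simp add: vec_eq_iff antiherm_def cscale_def sum_distrib_left sum_negf)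
  also have "\<dots> = - (T i ** T j - T j ** T i)"
    by (simp add: commutator_X[symmetric] m)
  also have "\<dots> = cscale (- \<i>) (\<Sum>k\<in>UNIV. f i j k *\<^sub>R T k)"
    by (simp add: commutator_T) (simp add: vec_eq_iff cscale_def)
  finally have eq: "(\<Sum>k\<in>UNIV. C i j k *\<^sub>R T k) = (\<Sum>k\<in>UNIV. f i j k *\<^sub>R T k)"
    by (simp add: vec_eq_iff cscale_def)
  have tr: "trace ((\<Sum>l\<in>UNIV. g l *\<^sub>R T l) ** T k) = of_real (g k) / 2" for g :: "'g \<Rightarrow> real"
  proof -
    have "trace ((\<Sum>l\<in>UNIV. g l *\<^sub>R T l) ** T k) = (\<Sum>l\<in>UNIV. of_real (g l) * trace (T l ** T k))"
    proof -
      have "trace ((\<Sum>l\<in>UNIV. g l *\<^sub>R T l) ** T k)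
          = (\<Sum>a\<in>UNIV. \<Sum>b\<in>UNIV. \<Sum>l\<in>UNIV. of_real (g l) * (T l $ a $ b * T k $ b $ a))"
        by (simp add: trace_def matrix_matrix_mult_def sum_distrib_right scaleR_conv_of_real[where 'a = complex]
            mult.assoc)
      also have "\<dots> = (\<Sum>a\<in>UNIV. \<Sum>l\<in>UNIV. \<Sum>b\<in>UNIV. of_real (g l) * (T l $ a $ b * T k $ b $ a))"
        by (intro sum.cong refl sum.swap)
      also have "\<dots> = (\<Sum>l\<in>UNIV. \<Sum>a\<in>UNIV. \<Sum>b\<in>UNIV. of_real (g l) * (T l $ a $ b * T k $ b $ a))"
        by (rule sum.swap)
      finally show ?thesis
        by (simp add: trace_def matrix_matrix_mult_def sum_distrib_left)
    qed
    also have "\<dots> = (\<Sum>l\<in>UNIV. if l = k then of_real (g k) / 2 else 0)"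
      by (intro sum.cong) (auto simp: trace_T_T)
    finally show ?thesis by simp
  qed
  from eq show ?thesis using tr[of "C i j"] tr[of "f i j"] by simp
qed


section \<open>Multi-indices and the generalised Kronecker symbol\<close>

text \<open>
  A multi-index \<open>i\<^sub>1 \<dots> i\<^sub>N\<close> is a function on \<open>nat\<close> of which only the values at the positions
  \<open>1, \<dots>, N\<close> matter; \<open>multi_indices N\<close> contains each such tuple exactly once.
\<close>

definition multi_indices :: "nat \<Rightarrow> (nat \<Rightarrow> 'g) set"
  where "multi_indices N = {1..N} \<rightarrow>\<^sub>E UNIV"

definition kdelta :: "'g \<Rightarrow> 'g \<Rightarrow> real"
  where "kdelta a b = (if a = b then 1 else 0)"

text \<open>The lower indices come first, the upper ones second.\<close>

definition eps :: "nat \<Rightarrow> (nat \<Rightarrow> 'g) \<Rightarrow> (nat \<Rightarrow> 'g) \<Rightarrow> real"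
  where "eps N \<alpha> \<beta> =
    (\<Sum>\<sigma> | \<sigma> permutes {1..N}. of_int (sign \<sigma>) * (\<Prod>k=1..N. kdelta (\<alpha> k) (\<beta> (\<sigma> k))))"


section \<open>The d-tensors and the primitive cocycles\<close>

text \<open>
  In the recursive clause the order \<open>r + 1\<close> of the paper is \<open>Suc (Suc (Suc (Suc r)))\<close>, so its last
  old slot is \<open>r + 3\<close>. Orders below 2 are not used and are set to 0.
\<close>

fun d_tensor :: "('g::finite \<Rightarrow> 'g \<Rightarrow> 'g \<Rightarrow> real) \<Rightarrow> nat \<Rightarrow> (nat \<Rightarrow> 'g) \<Rightarrow> real" where
  "d_tensor d 0 i = 0"
| "d_tensor d (Suc 0) i = 0"
| "d_tensor d (Suc (Suc 0)) i = kdelta (i 1) (i 2)"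
| "d_tensor d (Suc (Suc (Suc 0))) i = d (i 1) (i 2) (i 3)"
| "d_tensor d (Suc (Suc (Suc (Suc r)))) i =
     (\<Sum>j\<in>UNIV. d_tensor d (Suc (Suc (Suc r))) (i(r + 3 := j)) * d j (i (r + 3)) (i (r + 4)))"

lemma d_tensor_2: "d_tensor d 2 i = kdelta (i 1) (i 2)"
  by (simp add: eval_nat_numeral)

lemma d_tensor_3: "d_tensor d 3 i = d (i 1) (i 2) (i 3)"
  by (simp add: eval_nat_numeral)

lemma d_tensor_rec:
  assumes "r \<ge> 3"
  shows "d_tensor d (r + 1) i = (\<Sum>j\<in>UNIV. d_tensor d r (i(r := j)) * d j (i r) (i (r + 1)))"
proof -
  obtain q where "r = Suc (Suc (Suc q))"
    using assms by (metis Suc_le_D numeral_3_eq_3 Suc_le_mono)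
  then show ?thesis by (simp add: eval_nat_numeral)
qed

definition sym_d_tensor :: "('g::finite \<Rightarrow> 'g \<Rightarrow> 'g \<Rightarrow> real) \<Rightarrow> nat \<Rightarrow> (nat \<Rightarrow> 'g) \<Rightarrow> real"
  where "sym_d_tensor d r i = 1 / fact r * (\<Sum>\<sigma> | \<sigma> permutes {1..r}. d_tensor d r (i \<circ> \<sigma>))"

text \<open>\<open>Omega C d m\<close> is the cocycle \<open>\<Omega>\<close> of order \<open>2m - 1\<close>; it is meant for \<open>m \<ge> 2\<close>.\<close>

definition Omega ::
  "('g::finite \<Rightarrow> 'g \<Rightarrow> 'g \<Rightarrow> real) \<Rightarrow> ('g \<Rightarrow> 'g \<Rightarrow> 'g \<Rightarrow> real) \<Rightarrow> nat \<Rightarrow> (nat \<Rightarrow> 'g) \<Rightarrow> real"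
  where "Omega C d m i =
    1 / fact (2 * m - 1) *
      (\<Sum>j\<in>multi_indices (2 * m - 1). \<Sum>l\<in>multi_indices (m - 1).
         eps (2 * m - 1) i j
         * (\<Prod>k=1..m - 1. C (j (2 * k - 1)) (j (2 * k)) (l k))
         * sym_d_tensor d m (l(m := j (2 * m - 1))))"

end

(*
  Let theta = sum_k eta_k T_(i_k) with anticommuting symbols eta_1, ..., eta_N. The coefficient of
  eta_1 ... eta_N turns a tensor evaluated on theta into its antisymmetrisation at i, and
  F = C(theta, theta) is -2 i theta^2. In the ring of matrix-valued forms the contraction with d is
  the traceless part of the anticommutator. Since F is even and the traces of all even powers of
  theta vanish, every slot of the symmetrised d-tensor may carry the single odd entry with the same
  result, and the cocycle of order 2m-1 becomes (-4i)^(m-1) tr theta^(2m-1), up to the factorial.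
  By cyclicity of the trace the free index s of the previous cocycle can be moved to the last
  factor, so that the right-hand side is the trace of theta^(2m-4) (F theta + theta F), which is
  -4i tr theta^(2m-1).
*)
theory Submission
  imports Defs
begin

text \<open>Origin of the constants: each \<open>C\<close> contributes -2i, each of the m-2 nested
  anticommutators a factor 2, and the trace normalisation 1/2 a last factor 2. Two obstacles shape
  the proof. The contraction with \<open>d\<close> subtracts trace parts, and these need not vanish
  once the odd entry has been met; they are carried along as an unevaluated remainder, of which only
  a commutation rule and the vanishing of certain traces are recorded. Secondly, the index s of the
  previous cocycle is contracted and not alternated, so that cocycle cannot simply be replaced by a
  form in theta. It is expanded into signed traces over permutations. A trace of an odd number of
  factors can be rotated without a sign until s stands last; what remains permutes alternated
  indices only, and its sign cancels the one in the expansion. All (2m-3)! terms then agree and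
  cancel the factorial of the previous cocycle. Numerical and matrix-valued forms live in one ring,
  numbers being scalar matrices, so that trace parts can be subtracted from products.\<close>

section \<open>Square matrices as a ring\<close>

text \<open>The class operation \<open>*\<close> on \<open>'a^'n^'n\<close> is componentwise. On a
  type of its own it can be the matrix product, so that powers and the ring laws refer to that
  product.\<close>

typedef (overloaded) ('a, 'n::finite) sqmat = "UNIV :: ('a^'n^'n) set"
  by simp

setup_lifting type_definition_sqmat

instantiation sqmat :: (ring_1, finite) ring_1
begin

lift_definition zero_sqmat :: "('a, 'b) sqmat" is 0 .
lift_definition one_sqmat :: "('a, 'b) sqmat" is "mat 1" .
lift_definition plus_sqmat :: "('a, 'b) sqmat \<Rightarrow> ('a, 'b) sqmat \<Rightarrow> ('a, 'b) sqmat" is "(+)" .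
lift_definition minus_sqmat :: "('a, 'b) sqmat \<Rightarrow> ('a, 'b) sqmat \<Rightarrow> ('a, 'b) sqmat" is "(-)" .
lift_definition uminus_sqmat :: "('a, 'b) sqmat \<Rightarrow> ('a, 'b) sqmat" is uminus .
lift_definition times_sqmat :: "('a, 'b) sqmat \<Rightarrow> ('a, 'b) sqmat \<Rightarrow> ('a, 'b) sqmat" is "(**)" .

instance
proof
  fix a b c :: "('a, 'b) sqmat"
  show "(0::('a, 'b) sqmat) \<noteq> 1"
    by transfer (simp add: mat_def vec_eq_iff)
  show "a * b * c = a * (b * c)"
    by transfer (simp add: matrix_mul_assoc)
  show "1 * a = a"
    by transfer simp
  show "a * 1 = a"
    by transfer simp
  show "(a + b) * c = a * c + b * c"
    by transfer (simp add: matrix_matrix_mult_def vec_eq_iff distrib_right sum.distrib)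
  show "a * (b + c) = a * b + a * c"
    by transfer (simp add: matrix_matrix_mult_def vec_eq_iff distrib_left sum.distrib)
qed (transfer; simp)+

end

section \<open>Trace and scalar matrices\<close>

lift_definition mtrace :: "('a::ring_1, 'n::finite) sqmat \<Rightarrow> 'a" is trace .

lift_definition scal :: "'a::ring_1 \<Rightarrow> ('a, 'n::finite) sqmat" is mat .

lemma if_zero_mult:
  "(if P then x else 0) * y = (if P then x * y else 0)"
  "y * (if P then x else 0) = (if P then y * x else 0)" for x y :: "'a::ring_1"
  by simp_all

lemma mtrace_0 [simp]: "mtrace 0 = 0"
  by transfer (simp add: trace_def)

lemma mtrace_add: "mtrace (A + B) = mtrace A + mtrace B"
  by transfer (simp add: trace_def sum.distrib)

lemma mtrace_mult_commute:
  fixes A B :: "('a::comm_ring_1, 'n::finite) sqmat"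
  shows "mtrace (A * B) = mtrace (B * A)"
  by transfer (rule trace_mul_sym)

lemma scal_0 [simp]: "scal 0 = 0"
  by transfer (simp add: mat_def vec_eq_iff)

lemma scal_1 [simp]: "scal 1 = 1"
  by transfer simp

lemma scal_add: "scal (a + b) = scal a + scal b"
  by transfer (simp add: mat_def vec_eq_iff)

lemma scal_mult: "scal (a * b) = scal a * scal b"
  by transfer (simp add: mat_def matrix_matrix_mult_def vec_eq_iff if_zero_mult)

lemma scal_commute:
  fixes A :: "('a::comm_ring_1, 'n::finite) sqmat"
  shows "scal c * A = A * scal c"
  by transfer (simp add: mat_def matrix_matrix_mult_def vec_eq_iff if_zero_mult mult.commute)

lemma scal_inject [simp]: "scal a = scal b \<longleftrightarrow> a = b"
  by transfer (auto simp: mat_def vec_eq_iff)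

lemma mtrace_scal_mult: "mtrace (scal c * A) = c * mtrace A"
  by transfer (simp add: trace_def mat_def matrix_matrix_mult_def if_zero_mult sum_distrib_left)

lemma scal_uminus: "scal (- a) = - scal a"
  using scal_add[of a "- a"] by (simp add: eq_neg_iff_add_eq_0 add.commute)

lemma scal_of_nat: "scal (of_nat n) = of_nat n"
  by (induction n) (simp_all add: scal_add)

lemma scal_of_int: "scal (of_int k) = of_int k"
  by (cases k rule: int_cases2) (simp_all add: scal_uminus scal_of_nat)

lemma mtrace_sum: "mtrace (\<Sum>x\<in>A. f x) = (\<Sum>x\<in>A. mtrace (f x))"
  by (induction A rule: infinite_finite_induct) (simp_all add: mtrace_add)

lemma scal_sum: "scal (\<Sum>x\<in>A. f x) = (\<Sum>x\<in>A. scal (f x))"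
  by (induction A rule: infinite_finite_induct) (simp_all add: scal_add)

lemma mtrace_uminus: "mtrace (- A) = - mtrace A"
  using mtrace_add[of A "- A"] by (simp add: eq_neg_iff_add_eq_0 add.commute)

lemma mtrace_of_int_mult: "mtrace (of_int k * A) = of_int k * mtrace A"
  by (simp add: mtrace_scal_mult flip: scal_of_int)

lift_definition sqm :: "'a::ring_1^'n^'n::finite \<Rightarrow> ('a, 'n) sqmat" is "\<lambda>A. A" .

lemma sqm_add: "sqm (A + B) = sqm A + sqm B"
  by transfer simp

lemma sqm_diff: "sqm (A - B) = sqm A - sqm B"
  by transfer simp

lemma sqm_0 [simp]: "sqm 0 = 0"
  by transfer simp

lemma sqm_sum: "sqm (\<Sum>x\<in>A. f x) = (\<Sum>x\<in>A. sqm (f x))"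
  by (induction A rule: infinite_finite_induct) (simp_all add: sqm_add)

lemma sqm_mult: "sqm (A ** B) = sqm A * sqm B"
  by transfer simp

lemma sqm_mat: "sqm (mat c) = scal c"
  by transfer simp

lemma mtrace_sqm: "mtrace (sqm A) = trace A"
  by transfer simp

lemma sqm_cscale: "sqm (cscale c A) = scal c * sqm A"
  by transfer (simp add: cscale_def mat_def matrix_matrix_mult_def vec_eq_iff if_zero_mult)

lemma sqm_scaleR: "sqm (r *\<^sub>R A) = scal (complex_of_real r) * sqm A"
  by transfer (simp add: mat_def matrix_matrix_mult_def vec_eq_iff if_zero_mult scaleR_conv_of_real[where 'a = complex])

section \<open>The Grassmann algebra over a ring\<close>

text \<open>The sign of sorting the generators indexed by \<open>A\<close>, followed by those
  indexed by \<open>B\<close>, into increasing order: the exponent counts the pairs in the wrong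
  order.\<close>

definition shuffle_sign :: "nat set \<Rightarrow> nat set \<Rightarrow> int"
  where "shuffle_sign A B = (- 1) ^ card {(a, b) \<in> A \<times> B. b < a}"

lemma shuffle_sign_empty [simp]: "shuffle_sign {} B = 1" "shuffle_sign A {} = 1"
  by (simp_all add: shuffle_sign_def)

lemma shuffle_sign_Un_left:
  assumes "finite A" "finite B" "finite C" "A \<inter> B = {}"
  shows "shuffle_sign (A \<union> B) C = shuffle_sign A C * shuffle_sign B C"
proof -
  have "{(a, b) \<in> (A \<union> B) \<times> C. b < a} = {(a, b) \<in> A \<times> C. b < a} \<union> {(a, b) \<in> B \<times> C. b < a}"
    by auto
  moreover have "finite {(a, b) \<in> A \<times> C. b < a}" "finite {(a, b) \<in> B \<times> C. b < a}"
    using assms by (auto intro: finite_subset[of _ "A \<times> C"] finite_subset[of _ "B \<times> C"])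
  ultimately show ?thesis
    using assms unfolding shuffle_sign_def power_add[symmetric]
    by (subst card_Un_disjoint[symmetric]) auto
qed

lemma shuffle_sign_Un_right:
  assumes "finite A" "finite B" "finite C" "A \<inter> B = {}"
  shows "shuffle_sign C (A \<union> B) = shuffle_sign C A * shuffle_sign C B"
proof -
  have "{(a, b) \<in> C \<times> (A \<union> B). b < a} = {(a, b) \<in> C \<times> A. b < a} \<union> {(a, b) \<in> C \<times> B. b < a}"
    by auto
  moreover have "finite {(a, b) \<in> C \<times> A. b < a}" "finite {(a, b) \<in> C \<times> B. b < a}"
    using assms by (auto intro: finite_subset[of _ "C \<times> A"] finite_subset[of _ "C \<times> B"])
  ultimately show ?thesis
    using assms unfolding shuffle_sign_def power_add[symmetric]
    by (subst card_Un_disjoint[symmetric]) auto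
qed

text \<open>Each pair in \<open>A \<times> B\<close> is out of order in exactly one of the two
  arrangements, so the two inversion counts add up to \<open>card A * card B\<close>.\<close>

lemma shuffle_sign_swap:
  assumes "finite A" "finite B" "A \<inter> B = {}"
  shows "shuffle_sign A B = (- 1) ^ (card A * card B) * shuffle_sign B A"
proof -
  let ?P = "{(a, b) \<in> A \<times> B. b < a}" and ?Q = "{(b, a) \<in> B \<times> A. a < b}"
  have decomp: "A \<times> B = ?P \<union> prod.swap ` ?Q"
  proof (intro equalityI subsetI)
    fix x assume x: "x \<in> A \<times> B"
    obtain a b where ab: "x = (a, b)" by (cases x)
    with x assms(3) have "a \<noteq> b" by auto
    show "x \<in> ?P \<union> prod.swap ` ?Q"
    proof (cases "b < a")
      case False
      then have "prod.swap (b, a) \<in> prod.swap ` ?Q"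
        using \<open>a \<noteq> b\<close> x ab by (intro imageI) auto
      then show ?thesis by (simp add: ab)
    qed (use x ab in auto)
  qed auto
  have fin: "finite ?P" "finite ?Q"
    by (rule finite_subset[of _ "A \<times> B"], use assms in auto)
      (rule finite_subset[of _ "B \<times> A"], use assms in auto)
  have disj: "?P \<inter> prod.swap ` ?Q = {}" by auto
  have "card (A \<times> B) = card (?P \<union> prod.swap ` ?Q)"
    using decomp by (rule arg_cong)
  also have "\<dots> = card ?P + card (prod.swap ` ?Q)"
    by (rule card_Un_disjoint[OF fin(1) finite_imageI[OF fin(2)] disj])
  also have "card (prod.swap ` ?Q) = card ?Q"
    by (rule card_image) simp
  finally have "card A * card B = card ?P + card ?Q"
    by (simp add: card_cartesian_product)
  moreover have "(- 1) ^ k * ((- 1) ^ k) = (1::int)" for k :: nat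
    by (simp flip: power_mult_distrib)
  ultimately show ?thesis
    unfolding shuffle_sign_def by (simp only: power_add mult.assoc mult_1_right)
qed

text \<open>
  The value at a finite set \<open>S\<close> is the coefficient of the product of the generators \<open>\<eta>\<^sub>k\<close>, \<open>k \<in> S\<close>,
  taken in increasing order. The coefficients need not commute with each other, but they commute
  with the generators. As \<open>Pow S\<close> is infinite for infinite \<open>S\<close>, the product takes the junk value 0
  there; requiring 0 at infinite sets makes the unit law hold.
\<close>

typedef (overloaded) 'a exterior = "{x :: nat set \<Rightarrow> 'a::zero. \<forall>S. infinite S \<longrightarrow> x S = 0}"
  morphisms ecoeff Abs_exterior
  by auto

setup_lifting type_definition_exterior

lemma exterior_eqI:
  assumes "\<And>S. finite S \<Longrightarrow> ecoeff X S = ecoeff Y S"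
  shows "X = Y"
proof -
  have "ecoeff X S = ecoeff Y S" for S
    using assms ecoeff[of X] ecoeff[of Y] by (cases "finite S") auto
  then show ?thesis
    by (simp add: ext flip: ecoeff_inject)
qed

text \<open>Signs are central integers; collecting them in front brings both bracketings of a triple
  product to one shape, in which associativity can be checked termwise.\<close>

lemma of_int_mult_regroup:
  fixes x y z :: "'a::ring_1"
  shows "of_int s * ((of_int t * (x * y)) * z) = of_int (s * t) * (x * y * z)"
    and "of_int s * (x * (of_int t * (y * z))) = of_int (s * t) * (x * y * z)"
proof -
  have "x * (of_int t * (y * z)) = of_int t * (x * (y * z))"
    using mult_of_int_commute[of t x] by (simp flip: mult.assoc)
  then show "of_int s * (x * (of_int t * (y * z))) = of_int (s * t) * (x * y * z)"
    by (simp add: mult.assoc)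
qed (simp add: mult.assoc)

instantiation exterior :: (ring_1) ring_1
begin

lift_definition zero_exterior :: "'a exterior" is "\<lambda>_. 0" by simp
lift_definition one_exterior :: "'a exterior" is "\<lambda>S. if S = {} then 1 else 0" by auto
lift_definition plus_exterior :: "'a exterior \<Rightarrow> 'a exterior \<Rightarrow> 'a exterior" is "\<lambda>x y S. x S + y S"
  by auto
lift_definition minus_exterior :: "'a exterior \<Rightarrow> 'a exterior \<Rightarrow> 'a exterior" is "\<lambda>x y S. x S - y S"
  by auto
lift_definition uminus_exterior :: "'a exterior \<Rightarrow> 'a exterior" is "\<lambda>x S. - x S"
  by auto
lift_definition times_exterior :: "'a exterior \<Rightarrow> 'a exterior \<Rightarrow> 'a exterior"
  is "\<lambda>x y S. \<Sum>A\<in>Pow S. of_int (shuffle_sign A (S - A)) * (x A * y (S - A))"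
  by (simp add: finite_Pow_iff)

instance
proof
  fix a b c :: "'a exterior"
  show "(0::'a exterior) \<noteq> 1"
    by transfer (metis zero_neq_one)
  show "1 * a = a"
  proof (rule exterior_eqI)
    fix S :: "nat set" assume "finite S"
    have "(\<Sum>A\<in>Pow S. of_int (shuffle_sign A (S - A)) * ((if A = {} then 1 else 0) * ecoeff a (S - A)))
        = (\<Sum>A\<in>{{}}. of_int (shuffle_sign A (S - A)) * ((if A = {} then 1 else 0) * ecoeff a (S - A)))"
      using \<open>finite S\<close> by (intro sum.mono_neutral_right) auto
    then show "ecoeff (1 * a) S = ecoeff a S"
      by (simp add: times_exterior.rep_eq one_exterior.rep_eq)
  qed
  show "a * 1 = a"
  proof (rule exterior_eqI)
    fix S :: "nat set" assume "finite S"
    have "(\<Sum>A\<in>Pow S. of_int (shuffle_sign A (S - A)) * (ecoeff a A * (if S - A = {} then 1 else 0)))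
        = (\<Sum>A\<in>{S}. of_int (shuffle_sign A (S - A)) * (ecoeff a A * (if S - A = {} then 1 else 0)))"
      using \<open>finite S\<close> by (intro sum.mono_neutral_right) auto
    then show "ecoeff (a * 1) S = ecoeff a S"
      by (simp add: times_exterior.rep_eq one_exterior.rep_eq)
  qed
  show "(a + b) * c = a * c + b * c"
    by transfer (simp add: algebra_simps sum.distrib)
  show "a * (b + c) = a * b + a * c"
    by transfer (simp add: algebra_simps sum.distrib)
  show "a * b * c = a * (b * c)"
  proof (rule exterior_eqI)
    fix S :: "nat set" assume S: "finite S"
    have "ecoeff (a * b * c) S
        = (\<Sum>U\<in>Pow S. \<Sum>A\<in>Pow U. of_int (shuffle_sign U (S - U) * shuffle_sign A (U - A))
            * (ecoeff a A * ecoeff b (U - A) * ecoeff c (S - U)))"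
      unfolding times_exterior.rep_eq sum_distrib_left sum_distrib_right of_int_mult_regroup
      by (rule refl)
    also have "\<dots> = (\<Sum>(U, A)\<in>(SIGMA U:Pow S. Pow U). of_int (shuffle_sign U (S - U) * shuffle_sign A (U - A))
            * (ecoeff a A * ecoeff b (U - A) * ecoeff c (S - U)))"
      using S by (subst sum.Sigma) (auto intro: finite_subset)
    also have "\<dots> = (\<Sum>(A, B)\<in>(SIGMA A:Pow S. Pow (S - A)).
            of_int (shuffle_sign A (S - A) * shuffle_sign B (S - A - B))
            * (ecoeff a A * ecoeff b B * ecoeff c (S - A - B)))"
    \<comment> \<open>Both sides run over the ordered splittings of \<open>S\<close> into three
      parts, and the sign on either side is the product of the three pairwise shuffle signs.\<close>
    proof (rule sum.reindex_bij_witness[where j = "\<lambda>(U, A). (A, U - A)" and i = "\<lambda>(A, B). (A \<union> B, A)"])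
      fix x assume "x \<in> (SIGMA U:Pow S. Pow U)"
      then obtain U A where x: "x = (U, A)" and UA: "U \<subseteq> S" "A \<subseteq> U" by auto
      have fin: "finite A" "finite (U - A)" "finite (S - U)"
        using S UA by (auto intro: finite_subset)
      have "A \<union> (U - A) = U" "(U - A) \<union> (S - U) = S - A" and eq: "S - A - (U - A) = S - U"
        using UA by blast+
      then have "shuffle_sign U (S - U) = shuffle_sign A (S - U) * shuffle_sign (U - A) (S - U)"
        and "shuffle_sign A (S - A) = shuffle_sign A (U - A) * shuffle_sign A (S - U)"
        using shuffle_sign_Un_left[of A "U - A" "S - U"] shuffle_sign_Un_right[of "U - A" "S - U" A] fin
        by auto
      with eq have "shuffle_sign A (S - A) * shuffle_sign (U - A) (S - A - (U - A))
          = shuffle_sign U (S - U) * shuffle_sign A (U - A)"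
        by (simp only: mult_ac)
      with eq show "(case case x of (U, A) \<Rightarrow> (A, U - A) of (A, B) \<Rightarrow>
            of_int (shuffle_sign A (S - A) * shuffle_sign B (S - A - B))
            * (ecoeff a A * ecoeff b B * ecoeff c (S - A - B)))
          = (case x of (U, A) \<Rightarrow> of_int (shuffle_sign U (S - U) * shuffle_sign A (U - A))
            * (ecoeff a A * ecoeff b (U - A) * ecoeff c (S - U)))"
        by (simp only: x prod.case)
    qed auto
    also have "\<dots> = (\<Sum>A\<in>Pow S. \<Sum>B\<in>Pow (S - A). of_int (shuffle_sign A (S - A) * shuffle_sign B (S - A - B))
            * (ecoeff a A * ecoeff b B * ecoeff c (S - A - B)))"
      using S by (subst sum.Sigma) auto
    also have "\<dots> = ecoeff (a * (b * c)) S"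
      unfolding times_exterior.rep_eq sum_distrib_left sum_distrib_right of_int_mult_regroup
      by (rule refl)
    finally show "ecoeff (a * b * c) S = ecoeff (a * (b * c)) S" .
  qed
  show "a + b = b + a"
    by transfer (simp add: add.commute)
qed (transfer; simp add: add.assoc)+

end

lemmas ecoeff_simps [simp] = zero_exterior.rep_eq plus_exterior.rep_eq minus_exterior.rep_eq
  uminus_exterior.rep_eq

lemma ecoeff_sum [simp]: "ecoeff (\<Sum>x\<in>A. f x) S = (\<Sum>x\<in>A. ecoeff (f x) S)"
  by (induction A rule: infinite_finite_induct) simp_all

lemma ecoeff_infinite [simp]: "infinite S \<Longrightarrow> ecoeff X S = 0"
  using ecoeff[of X] by auto

lemma ecoeff_mult_eq:
  "ecoeff (X * Y) S = (\<Sum>A\<in>Pow S. of_int (shuffle_sign A (S - A)) * (ecoeff X A * ecoeff Y (S - A)))"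
  by (simp add: times_exterior.rep_eq)

text \<open>Indexes the terms of \<open>X * Y\<close> by the splitting that belongs to
  \<open>Y * X\<close>. The two products can then be compared term by term, with the sign as the
  only discrepancy.\<close>

lemma ecoeff_mult_swap:
  assumes "finite S"
  shows "ecoeff (X * Y) S
    = (\<Sum>A\<in>Pow S. (- 1) ^ (card A * card (S - A))
        * (of_int (shuffle_sign A (S - A)) * (ecoeff X (S - A) * ecoeff Y A)))"
proof -
  have "ecoeff (X * Y) S
      = (\<Sum>A\<in>Pow S. of_int (shuffle_sign (S - A) A) * (ecoeff X (S - A) * ecoeff Y A))"
    unfolding ecoeff_mult_eq
    by (rule sum.reindex_bij_witness[where i = "\<lambda>A. S - A" and j = "\<lambda>A. S - A"])
      (auto simp: double_diff)
  also have "\<dots> = (\<Sum>A\<in>Pow S. (- 1) ^ (card A * card (S - A))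
        * (of_int (shuffle_sign A (S - A)) * (ecoeff X (S - A) * ecoeff Y A)))"
  proof (rule sum.cong[OF refl])
    fix A assume "A \<in> Pow S"
    then have "shuffle_sign (S - A) A = (- 1) ^ (card A * card (S - A)) * shuffle_sign A (S - A)"
      using assms shuffle_sign_swap[of "S - A" A] by (auto intro: finite_subset simp: mult.commute)
    then show "of_int (shuffle_sign (S - A) A) * (ecoeff X (S - A) * ecoeff Y A)
        = (- 1) ^ (card A * card (S - A))
          * (of_int (shuffle_sign A (S - A)) * (ecoeff X (S - A) * ecoeff Y A))"
      by (simp add: mult.assoc)
  qed
  finally show ?thesis .
qed

section \<open>Constant forms, generators and parity\<close>

lift_definition const :: "'a::ring_1 \<Rightarrow> 'a exterior" is "\<lambda>c S. if S = {} then c else 0"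
  by auto

lemma const_0 [simp]: "const 0 = 0"
  by transfer auto

lemma const_1 [simp]: "const 1 = 1"
  by transfer auto

lemma const_add: "const (a + b) = const a + const b"
  by transfer auto

lemma const_diff: "const (a - b) = const a - const b"
  by transfer auto

lemma const_sum: "const (\<Sum>x\<in>A. f x) = (\<Sum>x\<in>A. const (f x))"
  by (induction A rule: infinite_finite_induct) (simp_all add: const_add)

lemma ecoeff_const_mult: "ecoeff (const c * X) S = c * ecoeff X S"
proof (cases "finite S")
  case True
  have "ecoeff (const c * X) S
      = (\<Sum>A\<in>{{}}. of_int (shuffle_sign A (S - A)) * (ecoeff (const c) A * ecoeff X (S - A)))"
    unfolding ecoeff_mult_eq using True
    by (intro sum.mono_neutral_right) (auto simp: const.rep_eq)
  then show ?thesis by (simp add: const.rep_eq)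
qed simp

lemma const_mult: "const (a * b) = const a * const b"
  by (rule exterior_eqI) (simp add: ecoeff_const_mult, simp add: const.rep_eq)

lift_definition eta :: "nat \<Rightarrow> 'a::ring_1 exterior" is "\<lambda>k S. if S = {k} then 1 else 0"
  by auto

text \<open>\<open>True\<close> stands for the odd forms, so that the parity of a product is \<open>p \<noteq> q\<close>.\<close>

definition homog :: "bool \<Rightarrow> 'a::ring_1 exterior \<Rightarrow> bool"
  where "homog p X \<longleftrightarrow> (\<forall>S. finite S \<longrightarrow> ecoeff X S \<noteq> 0 \<longrightarrow> odd (card S) = p)"

lemma homog_0 [simp]: "homog p 0"
  by (simp add: homog_def)

lemma homog_const [simp]: "homog False (const c)"
  by (simp add: homog_def const.rep_eq)

lemma homog_1 [simp]: "homog False 1"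
  using homog_const[of 1] by simp

lemma homog_eta [simp]: "homog True (eta k)"
  by (simp add: homog_def eta.rep_eq)

lemma homog_add: "homog p X \<Longrightarrow> homog p Y \<Longrightarrow> homog p (X + Y)"
  unfolding homog_def
proof (intro allI impI)
  fix S :: "nat set"
  assume *: "\<forall>S. finite S \<longrightarrow> ecoeff X S \<noteq> 0 \<longrightarrow> odd (card S) = p"
    "\<forall>S. finite S \<longrightarrow> ecoeff Y S \<noteq> 0 \<longrightarrow> odd (card S) = p" "finite S"
    and nz: "ecoeff (X + Y) S \<noteq> 0"
  have "ecoeff X S \<noteq> 0 \<or> ecoeff Y S \<noteq> 0" using nz by (cases "ecoeff X S = 0") simp_all
  with * show "odd (card S) = p" by blast
qed

lemma homog_sum: "(\<And>x. x \<in> A \<Longrightarrow> homog p (f x)) \<Longrightarrow> homog p (\<Sum>x\<in>A. f x)"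
  by (induction A rule: infinite_finite_induct) (auto intro: homog_add)

lemma homog_mult:
  assumes "homog p X" "homog q Y"
  shows "homog (p \<noteq> q) (X * Y)"
  unfolding homog_def
proof (intro allI impI)
  fix S :: "nat set"
  assume S: "finite S" and nz: "ecoeff (X * Y) S \<noteq> 0"
  from nz obtain A where A: "A \<subseteq> S"
    and "of_int (shuffle_sign A (S - A)) * (ecoeff X A * ecoeff Y (S - A)) \<noteq> 0"
    unfolding ecoeff_mult_eq by (auto elim!: sum.not_neutral_contains_not_neutral)
  then have "ecoeff X A \<noteq> 0" "ecoeff Y (S - A) \<noteq> 0" by auto
  moreover have "finite A" using A S finite_subset by blast
  ultimately have "odd (card A) = p" "odd (card (S - A)) = q"
    using assms S by (auto simp: homog_def)
  moreover have "card S = card A + card (S - A)"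
    using A S \<open>finite A\<close> by (simp add: card_Diff_subset card_mono)
  ultimately show "odd (card S) = (p \<noteq> q)" by auto
qed

lemma homog_power_even: "homog False X \<Longrightarrow> homog False (X ^ n)"
  by (induction n) (use homog_mult[of False _ False] in \<open>auto simp: power_Suc\<close>)

text \<open>The numerical forms inside the matrix-valued algebra: dual forms and traces are of this
  kind, and their coefficients commute with all matrices.\<close>

definition scalar_form :: "('a::comm_ring_1, 'n::finite) sqmat exterior \<Rightarrow> bool"
  where "scalar_form X \<longleftrightarrow> (\<forall>S. \<exists>c. ecoeff X S = scal c)"

lemma scalar_form_commute_coeff: "scalar_form X \<Longrightarrow> ecoeff X S * r = r * ecoeff X S"
  by (auto simp: scalar_form_def scal_commute dest: spec[of _ S])

text \<open>One even factor suffices: wherever both coefficients are nonzero, the exponent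
  \<open>card A * card (S - A)\<close> is even.\<close>

lemma scalar_form_commute:
  assumes "scalar_form X" "homog False X \<or> homog False Y"
  shows "X * Y = Y * X"
proof (rule exterior_eqI)
  fix S :: "nat set" assume S: "finite S"
  have "of_int (shuffle_sign A (S - A)) * (ecoeff X A * ecoeff Y (S - A))
      = (- 1) ^ (card A * card (S - A))
          * (of_int (shuffle_sign A (S - A)) * (ecoeff Y (S - A) * ecoeff X A))" if "A \<in> Pow S" for A
  proof (cases "ecoeff X A = 0 \<or> ecoeff Y (S - A) = 0")
    case False
    then have "even (card A * card (S - A))"
      using assms(2) S that by (auto simp: homog_def dest: finite_subset)
    then show ?thesis using scalar_form_commute_coeff[OF assms(1)] by simp
  qed auto
  then show "ecoeff (X * Y) S = ecoeff (Y * X) S"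
    unfolding ecoeff_mult_swap[OF S, of Y] unfolding ecoeff_mult_eq by (rule sum.cong[OF refl])
qed

lemma const_scalar_form_commute: "scalar_form X \<Longrightarrow> const A * X = X * const A"
  using scalar_form_commute[of X "const A"] by simp

lemma scalar_form_anticommute:
  assumes "scalar_form X" "homog True X" "homog True Y"
  shows "X * Y = - (Y * X)"
proof (rule exterior_eqI)
  fix S :: "nat set" assume S: "finite S"
  have "of_int (shuffle_sign A (S - A)) * (ecoeff X A * ecoeff Y (S - A))
      = - ((- 1) ^ (card A * card (S - A))
          * (of_int (shuffle_sign A (S - A)) * (ecoeff Y (S - A) * ecoeff X A)))" if "A \<in> Pow S" for A
  proof (cases "ecoeff X A = 0 \<or> ecoeff Y (S - A) = 0")
    case False
    then have "odd (card A * card (S - A))"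
      using assms(2,3) S that by (auto simp: homog_def dest: finite_subset)
    then show ?thesis using scalar_form_commute_coeff[OF assms(1)] by simp
  qed auto
  then show "ecoeff (X * Y) S = ecoeff (- (Y * X)) S"
    unfolding ecoeff_simps ecoeff_mult_swap[OF S, of Y] unfolding ecoeff_mult_eq sum_negf[symmetric]
    by (rule sum.cong[OF refl])
qed

text \<open>The trace is returned as a scalar matrix, so that trace parts can be subtracted and
  multiplied within the same ring.\<close>

lift_definition ftrace ::
    "('a::comm_ring_1, 'n::finite) sqmat exterior \<Rightarrow> ('a, 'n) sqmat exterior"
  is "\<lambda>x S. scal (mtrace (x S))"
  by auto

lemma scalar_form_ftrace [simp]: "scalar_form (ftrace X)"
  by (auto simp: scalar_form_def ftrace.rep_eq)

lemma ftrace_0 [simp]: "ftrace 0 = 0"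
  by (rule exterior_eqI) (simp add: ftrace.rep_eq)

lemma ftrace_add: "ftrace (X + Y) = ftrace X + ftrace Y"
  by (rule exterior_eqI) (simp add: ftrace.rep_eq mtrace_add scal_add)

lemma ftrace_uminus: "ftrace (- X) = - ftrace X"
  using ftrace_add[of X "- X"] by (simp add: eq_neg_iff_add_eq_0 add.commute)

lemma ftrace_diff: "ftrace (X - Y) = ftrace X - ftrace Y"
  using ftrace_add[of X "- Y"] by (simp add: ftrace_uminus)

lemma ftrace_sum: "ftrace (\<Sum>x\<in>A. f x) = (\<Sum>x\<in>A. ftrace (f x))"
  by (induction A rule: infinite_finite_induct) (simp_all add: ftrace_add)

lemma ftrace_scalar_mult:
  assumes "scalar_form X"
  shows "ftrace (X * Y) = X * ftrace Y"
proof (rule exterior_eqI)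
  fix S :: "nat set"
  obtain c where c: "\<And>A. ecoeff X A = scal (c A)"
    using assms unfolding scalar_form_def by metis
  show "ecoeff (ftrace (X * Y)) S = ecoeff (X * ftrace Y) S"
    by (simp add: ftrace.rep_eq ecoeff_mult_eq mtrace_sum scal_sum mtrace_of_int_mult scal_mult scal_of_int
        c mtrace_scal_mult)
qed

text \<open>Graded cyclicity: the matrix coefficients may be exchanged under the trace, and
  exchanging two odd monomials costs a sign.\<close>

lemma ftrace_mult_anticommute:
  assumes "homog True X" "homog True Y"
  shows "ftrace (X * Y) = - ftrace (Y * X)"
proof (rule exterior_eqI)
  fix S :: "nat set" assume S: "finite S"
  have "mtrace (of_int (shuffle_sign A (S - A)) * (ecoeff X A * ecoeff Y (S - A)))
      = - mtrace ((- 1) ^ (card A * card (S - A))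
          * (of_int (shuffle_sign A (S - A)) * (ecoeff Y (S - A) * ecoeff X A)))" if "A \<in> Pow S" for A
  proof (cases "ecoeff X A = 0 \<or> ecoeff Y (S - A) = 0")
    case False
    then have "odd (card A * card (S - A))"
      using assms S that by (auto simp: homog_def dest: finite_subset)
    then show ?thesis
      using mtrace_mult_commute[of "ecoeff X A" "ecoeff Y (S - A)"]
      by (simp add: mtrace_of_int_mult mtrace_uminus)
  qed auto
  then have "mtrace (ecoeff (X * Y) S) = - mtrace (ecoeff (Y * X) S)"
    unfolding ecoeff_mult_swap[OF S, of Y] unfolding ecoeff_mult_eq mtrace_sum sum_negf[symmetric]
    by (rule sum.cong[OF refl])
  then show "ecoeff (ftrace (X * Y)) S = ecoeff (- ftrace (Y * X)) S"
    by (simp add: ftrace.rep_eq scal_uminus)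
qed

section \<open>Ordered products\<close>

text \<open>The factors are numbered from 1, like the positions of a multi-index.\<close>

primrec oprod :: "(nat \<Rightarrow> 'a::monoid_mult) \<Rightarrow> nat \<Rightarrow> 'a" where
  "oprod f 0 = 1"
| "oprod f (Suc n) = oprod f n * f (Suc n)"

lemma oprod_cong: "(\<And>p. 1 \<le> p \<Longrightarrow> p \<le> n \<Longrightarrow> f p = g p) \<Longrightarrow> oprod f n = oprod g n"
  by (induction n) auto

lemma oprod_upd: "oprod (\<lambda>p. h p ((l(Suc r := a)) p)) r = oprod (\<lambda>p. h p (l p)) r"
  by (rule oprod_cong) simp

lemma oprod_const: "oprod (\<lambda>_. x) n = x ^ n"
  by (induction n) (simp_all add: power_commutes)

lemma oprod_commute:
  assumes "\<And>p. 1 \<le> p \<Longrightarrow> p \<le> n \<Longrightarrow> f p * x = x * f p"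
  shows "oprod f n * x = x * oprod f n"
  using assms
proof (induction n)
  case (Suc n)
  have "oprod f (Suc n) * x = oprod f n * (f (Suc n) * x)"
    by (simp add: mult.assoc)
  also have "\<dots> = oprod f n * x * f (Suc n)"
    using Suc.prems[of "Suc n"] by (simp add: mult.assoc)
  also have "\<dots> = x * oprod f (Suc n)"
    using Suc by (simp add: mult.assoc)
  finally show ?case .
qed simp

lemma oprod_mult:
  assumes "\<And>p q. g p * f q = f q * g p"
  shows "oprod (\<lambda>p. f p * g p) n = oprod f n * oprod g n"
proof (induction n)
  case (Suc n)
  have "oprod (\<lambda>p. f p * g p) (Suc n) = oprod f n * (oprod g n * f (Suc n)) * g (Suc n)"
    by (simp add: Suc.IH mult.assoc)
  also have "oprod g n * f (Suc n) = f (Suc n) * oprod g n"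
    by (rule oprod_commute) (rule assms)
  finally show ?case
    by (simp add: mult.assoc)
qed simp

lemma sum_PiE_Suc:
  "(\<Sum>k\<in>{1..Suc n} \<rightarrow>\<^sub>E A. g k) = (\<Sum>k\<in>{1..n} \<rightarrow>\<^sub>E A. \<Sum>a\<in>A. g (k(Suc n := a)))"
proof -
  have inj: "inj_on (\<lambda>(a, k). k(Suc n := a)) (A \<times> ({1..n} \<rightarrow>\<^sub>E A))"
  proof (rule inj_onI, clarify)
    fix a a' k k' assume eq: "k(Suc n := a) = k'(Suc n := a')"
      and k: "k \<in> {1..n} \<rightarrow>\<^sub>E A" "k' \<in> {1..n} \<rightarrow>\<^sub>E A"
    have "a = a'" using fun_cong[OF eq, of "Suc n"] by simp
    moreover have "k p = k' p" for p
    proof (cases "p = Suc n")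
      \<comment> \<open>Position \<open>Suc n\<close> lies outside \<open>{1..n}\<close>, where both
        tuples have the value \<open>undefined\<close>.\<close>
      case True then show ?thesis using k by (auto simp: PiE_def extensional_def)
    next
      case False then show ?thesis using fun_cong[OF eq, of p] by simp
    qed
    ultimately show "a = a' \<and> k = k'" by auto
  qed
  have "{1..Suc n} = insert (Suc n) {1..n}" by auto
  then have "(\<Sum>k\<in>{1..Suc n} \<rightarrow>\<^sub>E A. g k)
      = sum g ((\<lambda>(a, k). k(Suc n := a)) ` (A \<times> ({1..n} \<rightarrow>\<^sub>E A)))"
    by (simp only: PiE_insert_eq)
  also have "\<dots> = (\<Sum>(a, k)\<in>A \<times> ({1..n} \<rightarrow>\<^sub>E A). g (k(Suc n := a)))"
    unfolding sum.reindex[OF inj] by (simp add: case_prod_unfold)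
  also have "\<dots> = (\<Sum>a\<in>A. \<Sum>k\<in>{1..n} \<rightarrow>\<^sub>E A. g (k(Suc n := a)))"
    by (rule sum.cartesian_product[symmetric])
  also have "\<dots> = (\<Sum>k\<in>{1..n} \<rightarrow>\<^sub>E A. \<Sum>a\<in>A. g (k(Suc n := a)))"
    by (rule sum.swap)
  finally show ?thesis .
qed

lemma sum_multi_indices_Suc:
  "(\<Sum>k\<in>multi_indices (Suc n). g k) = (\<Sum>k\<in>multi_indices n. \<Sum>a\<in>UNIV. g (k(Suc n := a)))"
  unfolding multi_indices_def by (rule sum_PiE_Suc)

lemma sum_multi_indices_permute:
  fixes h :: "(nat \<Rightarrow> 'g) \<Rightarrow> 'b::comm_monoid_add"
  assumes "\<sigma> permutes {1..n}"
  shows "(\<Sum>l\<in>multi_indices n. h (l \<circ> \<sigma>)) = (\<Sum>l\<in>multi_indices n. h l)"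
proof (rule sum.reindex_bij_witness[where i = "\<lambda>l. l \<circ> inv \<sigma>" and j = "\<lambda>l. l \<circ> \<sigma>"])
  have mem: "l \<circ> \<tau> \<in> multi_indices n" if "l \<in> multi_indices n" "\<tau> permutes {1..n}" for l :: "nat \<Rightarrow> 'g" and \<tau>
    using that permutes_not_in[OF that(2)] by (auto simp: multi_indices_def PiE_def extensional_def)
  fix l :: "nat \<Rightarrow> 'g" assume l: "l \<in> multi_indices n"
  show "l \<circ> \<sigma> \<in> multi_indices n" "l \<circ> inv \<sigma> \<in> multi_indices n"
    using mem[OF l assms] mem[OF l permutes_inv[OF assms]] by simp_all
  show "l \<circ> \<sigma> \<circ> inv \<sigma> = l" "l \<circ> inv \<sigma> \<circ> \<sigma> = l"
    using permutes_inv_o[OF assms] by (simp_all only: o_assoc[symmetric] comp_id)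
qed simp_all

lemma oprod_sum_PiE:
  fixes h :: "nat \<Rightarrow> 'b \<Rightarrow> 'a::ring_1"
  shows "oprod (\<lambda>p. \<Sum>a\<in>A. h p a) n = (\<Sum>k\<in>{1..n} \<rightarrow>\<^sub>E A. oprod (\<lambda>p. h p (k p)) n)"
proof (induction n)
  case (Suc n)
  have "oprod (\<lambda>p. h p ((k(Suc n := a)) p)) n = oprod (\<lambda>p. h p (k p)) n" for k a
    by (rule oprod_cong) simp
  then show ?case
    by (simp only: oprod.simps Suc.IH sum_PiE_Suc sum_distrib_left sum_distrib_right fun_upd_same)
      (rule sum.swap)
qed simp

lemma oprod_sum:
  fixes h :: "nat \<Rightarrow> 'b::finite \<Rightarrow> 'a::ring_1"
  shows "oprod (\<lambda>p. \<Sum>a\<in>UNIV. h p a) n = (\<Sum>k\<in>multi_indices n. oprod (\<lambda>p. h p (k p)) n)"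
  unfolding multi_indices_def by (rule oprod_sum_PiE)

section \<open>Permuting the factors of an ordered product\<close>

lemma oprod_transpose_adjacent:
  fixes f :: "nat \<Rightarrow> 'a::ring_1"
  assumes comm: "\<And>p q. f p * f q = of_int \<epsilon> * (f q * f p)" and "1 \<le> a" "a < n"
  shows "oprod (f \<circ> Transposition.transpose a (Suc a)) n = of_int \<epsilon> * oprod f n"
  using \<open>a < n\<close>
proof (induction n)
  case (Suc n)
  show ?case
  proof (cases "a = n")
    case False
    with Suc show ?thesis by (simp add: Transposition.transpose_def mult.assoc)
  next
    case True
    obtain b where b: "a = Suc b" using \<open>1 \<le> a\<close> by (cases a) auto
    have n: "Suc n = Suc (Suc b)" by (simp add: b flip: True)
    have "oprod (f \<circ> Transposition.transpose a (Suc a)) b = oprod f b"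
      by (rule oprod_cong) (simp add: b Transposition.transpose_def)
    then have "oprod (f \<circ> Transposition.transpose a (Suc a)) (Suc n) = oprod f b * (f (Suc a) * f a)"
      unfolding n oprod.simps mult.assoc by (simp only: b o_apply transpose_apply_first transpose_apply_second)
    also have "\<dots> = (oprod f b * of_int \<epsilon>) * (f a * f (Suc a))"
      unfolding comm[of "Suc a" a] by (simp only: mult.assoc)
    also have "oprod f b * of_int \<epsilon> = of_int \<epsilon> * oprod f b"
      by (rule mult_of_int_commute[symmetric])
    finally show ?thesis
      unfolding n oprod.simps by (simp only: b mult.assoc)
  qed
qed simp

lemma oprod_transpose:
  fixes f :: "nat \<Rightarrow> 'a::ring_1"
  assumes "\<And>p q. f p * f q = of_int \<epsilon> * (f q * f p)" and \<epsilon>: "\<epsilon> * \<epsilon> = 1"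
    and "1 \<le> a" "a < b" "b \<le> n"
  shows "oprod (f \<circ> Transposition.transpose a b) n = of_int \<epsilon> * oprod f n"
  using \<open>a < b\<close> \<open>b \<le> n\<close> assms(1)
proof (induction b arbitrary: f)
  case (Suc b)
  note comm = Suc.prems(3)
  let ?t = "Transposition.transpose b (Suc b)"
  have swap: "oprod (g \<circ> ?t) n = of_int \<epsilon> * oprod g n"
    if "\<And>p q. g p * g q = of_int \<epsilon> * (g q * g p)" for g :: "nat \<Rightarrow> 'a"
    using Suc.prems(1,2) \<open>1 \<le> a\<close> by (intro oprod_transpose_adjacent[OF that]) simp_all
  show ?case
  proof (cases "a = b")
    case True
    show ?thesis unfolding True by (rule swap) (rule comm)
  next
    case False
    with Suc.prems(1) have "a < b" by simp
    \<comment> \<open>Conjugation by the adjacent swap: three transpositions, hence the factor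
      \<open>\<epsilon>\<close> cubed, which is \<open>\<epsilon>\<close>.\<close>
    have eq: "Transposition.transpose a (Suc b) = ?t \<circ> Transposition.transpose a b \<circ> ?t"
      using \<open>a < b\<close> by (auto simp: fun_eq_iff Transposition.transpose_def)
    have "oprod (f \<circ> Transposition.transpose a (Suc b)) n
        = oprod ((f \<circ> ?t \<circ> Transposition.transpose a b) \<circ> ?t) n"
      by (simp add: eq o_assoc)
    also have "\<dots> = of_int \<epsilon> * oprod ((f \<circ> ?t) \<circ> Transposition.transpose a b) n"
      by (rule swap) (unfold o_apply, rule comm)
    also have "oprod ((f \<circ> ?t) \<circ> Transposition.transpose a b) n = of_int \<epsilon> * oprod (f \<circ> ?t) n"
      using \<open>a < b\<close> Suc.prems(2) by (intro Suc.IH) (simp, simp, unfold o_apply, rule comm)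
    also have "oprod (f \<circ> ?t) n = of_int \<epsilon> * oprod f n"
      by (rule swap) (rule comm)
    also have "of_int \<epsilon> * (of_int \<epsilon> * (of_int \<epsilon> * oprod f n)) = of_int (\<epsilon> * \<epsilon>) * (of_int \<epsilon> * oprod f n)"
      by (simp add: mult.assoc)
    finally show ?thesis by (simp only: \<epsilon> of_int_1 mult_1_left)
  qed
qed simp

text \<open>The integer \<open>\<epsilon>\<close> is 1 for commuting and -1 for anticommuting
  factors, so that both cases share one induction over transpositions.\<close>

lemma oprod_permutes_aux:
  fixes f :: "nat \<Rightarrow> 'a::ring_1"
  assumes comm: "\<And>p q. f p * f q = of_int \<epsilon> * (f q * f p)" and \<epsilon>: "\<epsilon> = 1 \<or> \<epsilon> = - 1"
    and "\<sigma> permutes {1..n}"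
  shows "oprod (f \<circ> \<sigma>) n = of_int (if \<epsilon> = 1 then 1 else sign \<sigma>) * oprod f n"
  using finite_atLeastAtMost[of 1 n] \<open>\<sigma> permutes {1..n}\<close>
proof (induction rule: permutes_rev_induct)
  case id
  show ?case by simp
next
  case (swap a b \<sigma>)
  have \<epsilon>2: "\<epsilon> * \<epsilon> = 1" using \<epsilon> by auto
  have comm': "(f \<circ> \<sigma>) p * (f \<circ> \<sigma>) q = of_int \<epsilon> * ((f \<circ> \<sigma>) q * (f \<circ> \<sigma>) p)" for p q
    unfolding o_apply by (rule comm)
  have "oprod ((f \<circ> \<sigma>) \<circ> Transposition.transpose a b) n = of_int \<epsilon> * oprod (f \<circ> \<sigma>) n"
  proof (cases "a < b")
    case True
    with swap show ?thesis by (intro oprod_transpose[OF comm' \<epsilon>2]) auto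
  next
    case False
    with swap have "oprod ((f \<circ> \<sigma>) \<circ> Transposition.transpose b a) n = of_int \<epsilon> * oprod (f \<circ> \<sigma>) n"
      by (intro oprod_transpose[OF comm' \<epsilon>2]) auto
    then show ?thesis by (simp add: Transposition.transpose_commute)
  qed
  then have *: "oprod (f \<circ> (\<sigma> \<circ> Transposition.transpose a b)) n
      = of_int \<epsilon> * (of_int (if \<epsilon> = 1 then 1 else sign \<sigma>) * oprod f n)"
    by (simp only: o_assoc swap.IH)
  have **: "sign (\<sigma> \<circ> Transposition.transpose a b) = - sign \<sigma>"
    using swap by (subst sign_compose)
      (auto simp: sign_swap_id permutation_swap_id intro: permutation_permutes[THEN iffD2])
  show ?case
    unfolding * ** using \<epsilon> by auto
qed

lemma oprod_permutes:
  fixes f :: "nat \<Rightarrow> 'a::ring_1"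
  assumes "\<And>p q. f p * f q = - (f q * f p)" and "\<sigma> permutes {1..n}"
  shows "oprod (f \<circ> \<sigma>) n = of_int (sign \<sigma>) * oprod f n"
proof -
  have "f p * f q = of_int (- 1) * (f q * f p)" for p q
    using assms(1)[of p q] by simp
  from oprod_permutes_aux[OF this _ assms(2)] show ?thesis by simp
qed

lemma oprod_permutes_commute:
  fixes f :: "nat \<Rightarrow> 'a::ring_1"
  assumes "\<And>p q. f p * f q = f q * f p" and "\<sigma> permutes {1..n}"
  shows "oprod (f \<circ> \<sigma>) n = oprod f n"
proof -
  have "f p * f q = of_int 1 * (f q * f p)" for p q
    using assms(1)[of p q] by simp
  from oprod_permutes_aux[OF this _ assms(2)] show ?thesis by simp
qed

lemma oprod_Suc_shift: "oprod g (Suc n) = g 1 * oprod (\<lambda>p. g (Suc p)) n"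
  by (induction n) (simp_all add: mult.assoc)

lemma oprod_even_commute:
  fixes f :: "nat \<Rightarrow> 'a::ring_1"
  assumes "\<And>p. f p * x = - (x * f p)"
  shows "oprod f (2 * n) * x = x * oprod f (2 * n)"
proof (induction n)
  case (Suc n)
  have "f p * f q * x = x * (f p * f q)" for p q
    using assms[of q] by (simp add: mult.assoc) (simp add: assms flip: mult.assoc)
  then have "oprod f (2 * Suc n) * x = oprod f (2 * n) * x * (f (Suc (2 * n)) * f (Suc (Suc (2 * n))))"
    by (simp add: mult.assoc)
  then show ?case
    unfolding Suc.IH by (simp add: mult.assoc)
qed simp

section \<open>Monomials in the generators\<close>

lemma ecoeff_mult_eta:
  assumes "finite S"
  shows "ecoeff (X * eta k) S
    = (if k \<in> S then of_int (shuffle_sign (S - {k}) {k}) * ecoeff X (S - {k}) else 0)"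
proof (cases "k \<in> S")
  case True
  have "ecoeff (X * eta k) S
      = (\<Sum>A\<in>{S - {k}}. of_int (shuffle_sign A (S - A)) * (ecoeff X A * ecoeff (eta k) (S - A)))"
    unfolding ecoeff_mult_eq using assms by (intro sum.mono_neutral_right) (auto simp: eta.rep_eq)
  moreover have "S - (S - {k}) = {k}" using True by auto
  ultimately show ?thesis using True by (simp add: eta.rep_eq)
next
  case False
  then show ?thesis
    unfolding ecoeff_mult_eq by (auto intro!: sum.neutral simp: eta.rep_eq)
qed

lemma eta_anticommute: "eta k * eta l = - (eta l * (eta k :: 'a::ring_1 exterior))"
proof (rule exterior_eqI)
  fix S :: "nat set" assume S: "finite S"
  show "ecoeff (eta k * eta l) S = ecoeff (- (eta l * (eta k :: 'a exterior))) S"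
  proof (cases "k \<noteq> l \<and> S = {k, l}")
    case True
    then have "S - {l} = {k}" "S - {k} = {l}" by auto
    moreover have "shuffle_sign {k} {l} = - shuffle_sign {l} {k}"
      using shuffle_sign_swap[of "{k}" "{l}"] True by simp
    ultimately show ?thesis using True
      by (simp add: ecoeff_mult_eta eta.rep_eq)
  next
    \<comment> \<open>This includes \<open>k = l\<close>, where both coefficients vanish because
      \<open>S - {k} = {k}\<close> is impossible.\<close>
    case False
    then have "\<not> (l \<in> S \<and> S - {l} = {k})" "\<not> (k \<in> S \<and> S - {k} = {l})" by auto
    then show ?thesis using S by (auto simp: ecoeff_mult_eta eta.rep_eq)
  qed
qed

text \<open>At the top set \<open>{1..n}\<close> only surjective, hence bijective, choices of
  generators survive.\<close>

lemma ecoeff_oprod_eta_eq_0: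
  assumes "finite S" "S \<noteq> k ` {1..n}"
  shows "ecoeff (oprod (\<lambda>p. eta (k p)) n) S = 0"
  using assms
proof (induction n arbitrary: S)
  case 0
  then show ?case by (simp add: one_exterior.rep_eq)
next
  case (Suc n)
  have "{1..Suc n} = insert (Suc n) {1..n}" by auto
  with Suc.prems have "k (Suc n) \<notin> S \<or> S - {k (Suc n)} \<noteq> k ` {1..n}" by auto
  then show ?case
    using Suc by (auto simp: ecoeff_mult_eta)
qed

lemma ecoeff_oprod_eta_top: "ecoeff (oprod eta n) {1..n} = 1"
proof (induction n)
  case (Suc n)
  have "{1..Suc n} - {Suc n} = {1..n}" by auto
  moreover have "shuffle_sign {1..n} {Suc n} = 1"
  proof -
    have "{(a, b) \<in> {1..n} \<times> {Suc n}. b < a} = {}" by auto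
    then show ?thesis unfolding shuffle_sign_def by (simp only: card.empty power_0)
  qed
  ultimately show ?case using Suc by (simp add: ecoeff_mult_eta)
qed (simp add: one_exterior.rep_eq)

section \<open>Alternation by means of the Grassmann algebra\<close>

lemma scalar_form_0 [simp]: "scalar_form 0"
  by (auto simp: scalar_form_def intro: exI[of _ 0])

lemma scalar_form_const_scal: "scalar_form (const (scal c))"
  unfolding scalar_form_def
proof
  show "\<exists>b. ecoeff (const (scal c)) S = scal b" for S
    by (rule exI[of _ "if S = {} then c else 0"]) (simp add: const.rep_eq)
qed

lemma scalar_form_eta [simp]: "scalar_form (eta k)"
  unfolding scalar_form_def
proof
  show "\<exists>b. ecoeff (eta k) S = scal b" for S
    by (rule exI[of _ "if S = {k} then 1 else 0"]) (simp add: eta.rep_eq)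
qed

lemma scalar_form_add: "scalar_form X \<Longrightarrow> scalar_form Y \<Longrightarrow> scalar_form (X + Y)"
  unfolding scalar_form_def ecoeff_simps by (metis scal_add)

lemma scalar_form_sum: "(\<And>x. x \<in> A \<Longrightarrow> scalar_form (f x)) \<Longrightarrow> scalar_form (\<Sum>x\<in>A. f x)"
  by (induction A rule: infinite_finite_induct) (auto intro: scalar_form_add)

lemma scalar_form_mult:
  assumes "scalar_form X" "scalar_form Y"
  shows "scalar_form (X * Y)"
proof -
  obtain b c where bc: "\<And>A. ecoeff X A = scal (b A)" "\<And>A. ecoeff Y A = scal (c A)"
    using assms unfolding scalar_form_def by metis
  have "ecoeff (X * Y) S
      = scal (\<Sum>A\<in>Pow S. of_int (shuffle_sign A (S - A)) * (b A * c (S - A)))" for S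
    by (simp add: ecoeff_mult_eq bc scal_sum scal_mult scal_of_int)
  then show ?thesis unfolding scalar_form_def by blast
qed

lemma scalar_form_oprod: "(\<And>p. scalar_form (f p)) \<Longrightarrow> scalar_form (oprod f n)"
  using scalar_form_const_scal[of 1] by (induction n) (auto intro: scalar_form_mult)

definition cform :: "complex \<Rightarrow> (complex, 'n::finite) sqmat exterior"
  where "cform c = const (scal c)"

lemma cform_0 [simp]: "cform 0 = 0"
  by (simp add: cform_def)

lemma cform_1 [simp]: "cform 1 = 1"
  by (simp add: cform_def)

lemma cform_add: "cform (a + b) = cform a + cform b"
  by (simp add: cform_def scal_add const_add)

lemma cform_mult: "cform (a * b) = cform a * cform b"
  by (simp add: cform_def scal_mult const_mult)

lemma cform_sum: "cform (\<Sum>x\<in>A. f x) = (\<Sum>x\<in>A. cform (f x))"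
  by (simp add: cform_def scal_sum const_sum)

lemma cform_uminus: "cform (- a) = - cform a"
  using cform_add[of a "- a"] by (simp add: eq_neg_iff_add_eq_0 add.commute)

lemma homog_cform [simp]: "homog False (cform c)"
  by (simp add: cform_def)

lemma scalar_form_cform [simp]: "scalar_form (cform c)"
  unfolding cform_def by (rule scalar_form_const_scal)

lemma cform_commute: "X * cform c = cform c * X"
  using scalar_form_commute[of "cform c" X] by simp

lemma cform_left_commute: "X * (cform c * Y) = cform c * (X * Y)"
  by (metis cform_commute mult.assoc)

lemma cform_mult_power: "(cform c * X) ^ k = cform (c ^ k) * X ^ k"
  by (induction k) (simp_all add: cform_mult cform_left_commute[of X] mult.assoc)

lemma ecoeff_cform_mult: "ecoeff (cform c * X) S = scal c * ecoeff X S"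
  by (simp add: cform_def ecoeff_const_mult)

lemma ftrace_cform_mult: "ftrace (cform c * X) = cform c * ftrace X"
  by (simp add: ftrace_scalar_mult)

lemma ftrace_const: "ftrace (const A) = cform (mtrace A)"
  by (rule exterior_eqI) (simp add: ftrace.rep_eq const.rep_eq cform_def)

text \<open>Multiplication by \<open>cform (1 / 2)\<close> serves as division by 2 in the ring of
  forms.\<close>

lemma form_eq_neg_self:
  fixes X :: "(complex, 'n::finite) sqmat exterior"
  assumes "X = - X"
  shows "X = 0"
proof -
  have "X + X = 0"
    using assms by (simp add: eq_neg_iff_add_eq_0)
  then have "cform (1 / 2) * X + cform (1 / 2) * X = 0"
    by (simp flip: distrib_left)
  then show ?thesis
    by (simp flip: distrib_right cform_add)
qed

lemma oprod_cform: "oprod (\<lambda>p. cform (c p)) n = cform (\<Prod>p=1..n. c p)"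
  by (induction n) (simp_all add: cform_mult)

lemma oprod_const_form: "oprod (\<lambda>p. const (c p)) n = const (oprod c n)"
  by (induction n) (simp_all add: const_mult)

text \<open>
  The form \<open>\<theta>\<^sup>a = \<Sum>\<^sub>k \<delta>(i\<^sub>k, a) \<eta>\<^sub>k\<close>: the top coefficient of \<open>\<theta>\<^sup>j\<^sup>1 \<dots> \<theta>\<^sup>j\<^sup>N\<close> is the symbol \<open>\<epsilon>\<close> with
  lower indices \<open>i\<close> and upper indices \<open>j\<close>.
\<close>

definition dual_form :: "(nat \<Rightarrow> 'g) \<Rightarrow> nat \<Rightarrow> 'g \<Rightarrow> (complex, 'n::finite) sqmat exterior"
  where "dual_form i N a = (\<Sum>k\<in>{1..N}. cform (of_real (kdelta (i k) a)) * eta k)"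

lemma scalar_form_dual_form [simp]: "scalar_form (dual_form i N a)"
  unfolding dual_form_def by (intro scalar_form_sum scalar_form_mult) simp_all

lemma homog_dual_form [simp]: "homog True (dual_form i N a)"
  unfolding dual_form_def
  by (intro homog_sum homog_mult[of False _ True, simplified]) simp_all

lemma ecoeff_oprod_dual_form:
  "ecoeff (oprod (\<lambda>p. dual_form i N (j p)) N :: (complex, 'n::finite) sqmat exterior) {1..N}
    = scal (of_real (eps N i j))"
proof -
  let ?I = "{1..N}"
  let ?D = "\<lambda>k. \<Prod>p=1..N. complex_of_real (kdelta (i (k p)) (j p))"
  let ?P = "{\<sigma>. \<sigma> permutes ?I}"
  let ?e = "\<lambda>k. scal (?D k) * ecoeff (oprod (\<lambda>p. eta (k p)) N :: (complex, 'n) sqmat exterior) ?I"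
  have "ecoeff (oprod (\<lambda>p. dual_form i N (j p)) N :: (complex, 'n) sqmat exterior) ?I = (\<Sum>k\<in>?I \<rightarrow>\<^sub>E ?I. ?e k)"
    unfolding dual_form_def oprod_sum_PiE
    by (subst oprod_mult) (simp_all add: cform_commute oprod_cform ecoeff_cform_mult)
  \<comment> \<open>A selection of generators that misses some position does not reach the top
    monomial.\<close>
  also have "\<dots> = (\<Sum>k\<in>{k \<in> ?I \<rightarrow>\<^sub>E ?I. k ` ?I = ?I}. ?e k)"
  proof (rule sum.mono_neutral_right)
    show "\<forall>k\<in>(?I \<rightarrow>\<^sub>E ?I) - {k \<in> ?I \<rightarrow>\<^sub>E ?I. k ` ?I = ?I}. ?e k = 0"
    proof
      fix k assume "k \<in> (?I \<rightarrow>\<^sub>E ?I) - {k \<in> ?I \<rightarrow>\<^sub>E ?I. k ` ?I = ?I}"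
      then have "?I \<noteq> k ` ?I" by blast
      then have "ecoeff (oprod (\<lambda>p. eta (k p)) N :: (complex, 'n) sqmat exterior) ?I = 0"
        by (rule ecoeff_oprod_eta_eq_0[OF finite_atLeastAtMost])
      then show "?e k = 0" by (simp only: mult_zero_right)
    qed
  qed (auto intro: finite_PiE)
  also have "\<dots> = (\<Sum>\<sigma>\<in>?P. ?e \<sigma>)"
  \<comment> \<open>Selections are \<open>undefined\<close> outside \<open>{1..N}\<close>,
    permutations are the identity there; the two witnesses exchange these defaults.\<close>
  proof (rule sum.reindex_bij_witness[where i = "\<lambda>\<sigma>. restrict \<sigma> ?I"
        and j = "\<lambda>k p. if p \<in> ?I then k p else p"])
    fix k assume k: "k \<in> {k \<in> ?I \<rightarrow>\<^sub>E ?I. k ` ?I = ?I}"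
    then have "bij_betw k ?I ?I"
      by (auto simp: bij_betw_def intro: eq_card_imp_inj_on)
    then have "bij_betw (\<lambda>p. if p \<in> ?I then k p else p) ?I ?I"
      by (subst bij_betw_cong[of _ _ k]) auto
    then show "(\<lambda>p. if p \<in> ?I then k p else p) \<in> ?P"
      by (auto intro: bij_imp_permutes)
    show "restrict (\<lambda>p. if p \<in> ?I then k p else p) ?I = k"
      using k by (auto simp: fun_eq_iff PiE_def extensional_def)
    show "?e (\<lambda>p. if p \<in> ?I then k p else p) = ?e k"
      by (intro arg_cong2[of _ _ _ _ "(*)"] arg_cong[of _ _ scal] prod.cong
          arg_cong2[of _ _ _ _ ecoeff] oprod_cong) auto
  next
    fix \<sigma> assume "\<sigma> \<in> ?P"
    then have \<sigma>: "\<sigma> permutes ?I" by simp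
    then show "restrict \<sigma> ?I \<in> {k \<in> ?I \<rightarrow>\<^sub>E ?I. k ` ?I = ?I}"
      using permutes_image[OF \<sigma>] by auto
    show "(\<lambda>p. if p \<in> ?I then restrict \<sigma> ?I p else p) = \<sigma>"
      using permutes_not_in[OF \<sigma>] by (auto simp: fun_eq_iff)
  qed
  also have "\<dots> = (\<Sum>\<sigma>\<in>?P. scal (of_int (sign \<sigma>) * ?D \<sigma>))"
  proof (rule sum.cong[OF refl])
    fix \<sigma> assume "\<sigma> \<in> ?P"
    then have "oprod (eta \<circ> \<sigma>) N = (of_int (sign \<sigma>) * oprod eta N :: (complex, 'n) sqmat exterior)"
      by (intro oprod_permutes eta_anticommute) simp
    also have "of_int (sign \<sigma>) = (cform (of_int (sign \<sigma>)) :: (complex, 'n) sqmat exterior)"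
      by (cases \<sigma> rule: sign_cases) (simp_all add: cform_uminus)
    finally have "ecoeff (oprod (\<lambda>p. eta (\<sigma> p)) N :: (complex, 'n) sqmat exterior) ?I = scal (of_int (sign \<sigma>))"
      by (simp add: o_def ecoeff_cform_mult ecoeff_oprod_eta_top flip: One_nat_def)
    then show "?e \<sigma> = scal (of_int (sign \<sigma>) * ?D \<sigma>)"
      by (simp add: mult.commute flip: scal_mult)
  qed
  also have "\<dots> = scal (\<Sum>\<sigma>\<in>?P. of_int (sign \<sigma>) * ?D \<sigma>)"
    by (simp add: scal_sum)
  \<comment> \<open>The expansion permutes the lower indices, whereas \<open>eps\<close> permutes
    the upper ones; passing to the inverse keeps the sign.\<close>
  also have "(\<Sum>\<sigma>\<in>?P. of_int (sign \<sigma>) * ?D \<sigma>) = (\<Sum>\<sigma>\<in>?P. of_int (sign (inv \<sigma>)) * ?D (inv \<sigma>))"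
    by (rule sum_permutations_inverse)
  also have "\<dots> = of_real (eps N i j)"
    unfolding eps_def of_real_sum
  proof (rule sum.cong[OF refl])
    fix \<sigma> assume "\<sigma> \<in> ?P"
    then have \<sigma>: "\<sigma> permutes ?I" by simp
    have "?D (inv \<sigma>) = (\<Prod>p=1..N. complex_of_real (kdelta (i (inv \<sigma> (\<sigma> p))) (j (\<sigma> p))))"
      using prod.permute[OF \<sigma>, of "\<lambda>p. complex_of_real (kdelta (i (inv \<sigma> p)) (j p))"]
      by (simp add: o_def)
    then show "of_int (sign (inv \<sigma>)) * ?D (inv \<sigma>)
        = of_real (of_int (sign \<sigma>) * (\<Prod>k=1..N. kdelta (i k) (j (\<sigma> k))))"
      using \<sigma> permutes_inverses(2)[OF \<sigma>]
      by (simp add: sign_inverse permutes_imp_permutation[of ?I])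
  qed
  finally show ?thesis .
qed

text \<open>A generating form for alternated tensors: the contraction of \<open>g\<close> with
  \<open>eps\<close> is its top coefficient, so identities between such contractions can be proved
  as identities in the ring and read off by \<open>alt_form_eq_imp_sum_eq\<close>.\<close>

definition alt_form :: "(nat \<Rightarrow> 'g::finite) \<Rightarrow> nat \<Rightarrow> ((nat \<Rightarrow> 'g) \<Rightarrow> complex)
    \<Rightarrow> (complex, 'n::finite) sqmat exterior"
  where "alt_form i N g =
    (\<Sum>j\<in>multi_indices N. oprod (\<lambda>p. dual_form i N (j p)) N * cform (g j))"

lemma ecoeff_alt_form:
  "ecoeff (alt_form i N g :: (complex, 'n::finite) sqmat exterior) {1..N} = scal (\<Sum>j\<in>multi_indices N. of_real (eps N i j) * g j)"
proof -
  have "ecoeff (oprod (\<lambda>p. dual_form i N (j p)) N * cform (g j) :: (complex, 'n) sqmat exterior) {1..N}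
      = scal (of_real (eps N i j) * g j)" for j
    unfolding cform_commute ecoeff_cform_mult ecoeff_oprod_dual_form
    by (simp add: mult.commute flip: scal_mult)
  then show ?thesis
    by (simp only: alt_form_def ecoeff_sum scal_sum)
qed

lemma alt_form_Suc:
  "alt_form i (Suc n) g = (\<Sum>j\<in>multi_indices n. \<Sum>a\<in>UNIV.
    oprod (\<lambda>p. dual_form i (Suc n) (j p)) n * dual_form i (Suc n) a * cform (g (j(Suc n := a))))"
  unfolding alt_form_def sum_multi_indices_Suc oprod.simps fun_upd_same
  by (subst oprod_upd) (rule refl)

lemma alt_form_lincomb:
  "alt_form i N (\<lambda>j. \<Sum>x\<in>A. c * g x j) = cform c * (\<Sum>x\<in>A. alt_form i N (g x))"
proof -
  have "alt_form i N (\<lambda>j. \<Sum>x\<in>A. c * g x j)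
      = (\<Sum>j\<in>multi_indices N. \<Sum>x\<in>A. cform c * (oprod (\<lambda>p. dual_form i N (j p)) N * cform (g x j)))"
    unfolding alt_form_def cform_sum sum_distrib_left
    by (intro sum.cong refl) (simp only: cform_mult cform_left_commute[of "oprod _ _"])
  also have "\<dots> = (\<Sum>x\<in>A. \<Sum>j\<in>multi_indices N. cform c * (oprod (\<lambda>p. dual_form i N (j p)) N * cform (g x j)))"
    by (rule sum.swap)
  finally show ?thesis
    by (simp only: alt_form_def sum_distrib_left)
qed

lemma alt_form_eq_imp_sum_eq:
  assumes "(alt_form i N g :: (complex, 'n::finite) sqmat exterior) = cform c * alt_form i N h"
  shows "(\<Sum>j\<in>multi_indices N. of_real (eps N i j) * g j)
    = c * (\<Sum>j\<in>multi_indices N. of_real (eps N i j) * h j)"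
proof -
  have "ecoeff (alt_form i N g :: (complex, 'n) sqmat exterior) {1..N}
      = scal c * ecoeff (alt_form i N h :: (complex, 'n) sqmat exterior) {1..N}"
    unfolding assms by (rule ecoeff_cform_mult)
  then show ?thesis
    unfolding ecoeff_alt_form scal_mult[symmetric] by simp
qed

text \<open>Each permutation in \<open>eps\<close> selects one tuple, which agrees with
  \<open>i \<circ> inv \<sigma>\<close> on \<open>{1..N}\<close>. Outside, the tuple is
  \<open>undefined\<close> while \<open>i\<close> is arbitrary; the hypothesis \<open>local\<close>
  bridges this difference.\<close>

lemma sum_eps:
  fixes g :: "(nat \<Rightarrow> 'g::finite) \<Rightarrow> complex"
  assumes local: "\<And>j j'. (\<And>p. 1 \<le> p \<Longrightarrow> p \<le> N \<Longrightarrow> j p = j' p) \<Longrightarrow> g j = g j'"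
  shows "(\<Sum>j\<in>multi_indices N. of_real (eps N i j) * g j)
    = (\<Sum>\<sigma> | \<sigma> permutes {1..N}. of_int (sign \<sigma>) * g (i \<circ> \<sigma>))"
proof -
  let ?S = "{\<sigma>. \<sigma> permutes {1..N}}"
  let ?D = "\<lambda>\<sigma> j. complex_of_real (\<Prod>k=1..N. kdelta (i k) (j (\<sigma> k)))"
  have fin: "finite (multi_indices N :: (nat \<Rightarrow> 'g) set)"
    unfolding multi_indices_def by (rule finite_PiE) simp_all
  have inner: "(\<Sum>j\<in>multi_indices N. ?D \<sigma> j * g j) = g (i \<circ> inv \<sigma>)" if "\<sigma> \<in> ?S" for \<sigma>
  proof -
    have \<sigma>: "\<sigma> permutes {1..N}" using that by simp
    let ?j = "restrict (i \<circ> inv \<sigma>) {1..N}"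
    have mem: "?j \<in> multi_indices N" by (simp add: multi_indices_def)
    have "?D \<sigma> j * g j = (if j = ?j then g j else 0)" if "j \<in> multi_indices N" for j
    proof (cases "j = ?j")
      case True
      have "?j (\<sigma> k) = i k" if "k \<in> {1..N}" for k
        using permutes_in_image[OF \<sigma>, of k] permutes_inverses(2)[OF \<sigma>, of k] that by simp
      then have "?D \<sigma> ?j = 1" by (simp add: kdelta_def)
      then show ?thesis unfolding True by simp
    next
      case False
      then obtain p where p: "j p \<noteq> ?j p" by (meson ext)
      have pN: "p \<in> {1..N}"
      proof (rule ccontr)
        assume out: "p \<notin> {1..N}"
        then have "?j p = undefined" unfolding restrict_apply by (rule if_not_P)
        with p PiE_arb[OF that[unfolded multi_indices_def] out] show False
          by (simp only: simp_thms)
      qed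
      have "inv \<sigma> p \<in> {1..N}" "\<sigma> (inv \<sigma> p) = p"
        using permutes_in_image[OF permutes_inv[OF \<sigma>], of p] permutes_inverses(1)[OF \<sigma>, of p] pN by simp_all
      moreover have "kdelta (i (inv \<sigma> p)) (j p) = 0"
        using p pN by (simp add: kdelta_def)
      ultimately have "?D \<sigma> j = 0"
        by (auto intro!: bexI[of _ "inv \<sigma> p"])
      then show ?thesis using False by simp
    qed
    then have "(\<Sum>j\<in>multi_indices N. ?D \<sigma> j * g j) = (\<Sum>j\<in>multi_indices N. if j = ?j then g j else 0)"
      by (rule sum.cong[OF refl])
    also have "\<dots> = g ?j"
      using fin mem by simp
    also have "\<dots> = g (i \<circ> inv \<sigma>)"
      by (rule local) simp
    finally show ?thesis .
  qed
  have "(\<Sum>j\<in>multi_indices N. of_real (eps N i j) * g j)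
      = (\<Sum>j\<in>multi_indices N. \<Sum>\<sigma>\<in>?S. of_int (sign \<sigma>) * (?D \<sigma> j * g j))"
    by (simp add: eps_def sum_distrib_right mult.assoc)
  also have "\<dots> = (\<Sum>\<sigma>\<in>?S. of_int (sign \<sigma>) * (\<Sum>j\<in>multi_indices N. ?D \<sigma> j * g j))"
    unfolding sum_distrib_left by (rule sum.swap)
  also have "\<dots> = (\<Sum>\<sigma>\<in>?S. of_int (sign (inv \<sigma>)) * g (i \<circ> inv \<sigma>))"
    by (intro sum.cong refl arg_cong2[of _ _ _ _ "(*)"] inner)
      (auto simp: sign_inverse permutes_imp_permutation[of "{1..N}"])
  also have "\<dots> = (\<Sum>\<sigma>\<in>?S. of_int (sign \<sigma>) * g (i \<circ> \<sigma>))"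
    by (rule sum_permutations_inverse[symmetric])
  finally show ?thesis .
qed

text \<open>Written as a signed sum over permutations, the contraction is reindexed by composition
  with \<open>\<tau>\<close>, which changes every sign by \<open>sign \<tau>\<close>.\<close>

lemma sum_eps_permute:
  fixes g :: "(nat \<Rightarrow> 'g::finite) \<Rightarrow> complex"
  assumes local: "\<And>j j'. (\<And>p. 1 \<le> p \<Longrightarrow> p \<le> N \<Longrightarrow> j p = j' p) \<Longrightarrow> g j = g j'"
    and \<tau>: "\<tau> permutes {1..N}"
  shows "(\<Sum>j\<in>multi_indices N. of_real (eps N i j) * g (j \<circ> \<tau>))
    = of_int (sign \<tau>) * (\<Sum>j\<in>multi_indices N. of_real (eps N i j) * g j)"
proof -
  let ?S = "{\<sigma>. \<sigma> permutes {1..N}}"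
  have perm: "permutation \<sigma>" if "\<sigma> permutes {1..N}" for \<sigma> :: "nat \<Rightarrow> nat"
    using that by (rule permutes_imp_permutation[rotated]) simp
  have "(\<Sum>j\<in>multi_indices N. of_real (eps N i j) * g (j \<circ> \<tau>))
      = (\<Sum>\<sigma>\<in>?S. of_int (sign \<sigma>) * g (i \<circ> \<sigma> \<circ> \<tau>))"
  proof (rule sum_eps)
    fix j j' :: "nat \<Rightarrow> 'g" assume eq: "\<And>p. 1 \<le> p \<Longrightarrow> p \<le> N \<Longrightarrow> j p = j' p"
    show "g (j \<circ> \<tau>) = g (j' \<circ> \<tau>)"
    proof (rule local)
      fix p assume "1 \<le> p" "p \<le> N"
      then show "(j \<circ> \<tau>) p = (j' \<circ> \<tau>) p"
        using permutes_in_image[OF \<tau>, of p] eq[of "\<tau> p"] by simp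
    qed
  qed
  also have "\<dots> = (\<Sum>\<sigma>\<in>?S. of_int (sign \<tau>) * (of_int (sign (\<sigma> \<circ> \<tau>)) * g (i \<circ> (\<sigma> \<circ> \<tau>))))"
  proof (rule sum.cong[OF refl])
    fix \<sigma> assume "\<sigma> \<in> ?S"
    then have "sign (\<sigma> \<circ> \<tau>) = sign \<sigma> * sign \<tau>"
      using sign_compose[OF perm perm[OF \<tau>]] by blast
    then have "sign \<tau> * sign (\<sigma> \<circ> \<tau>) = sign \<sigma>"
      by (cases \<tau> rule: sign_cases) simp_all
    then have "of_int (sign \<sigma>) = (of_int (sign \<tau>) * of_int (sign (\<sigma> \<circ> \<tau>)) :: complex)"
      by (simp flip: of_int_mult)
    then show "of_int (sign \<sigma>) * g (i \<circ> \<sigma> \<circ> \<tau>) = of_int (sign \<tau>) * (of_int (sign (\<sigma> \<circ> \<tau>)) * g (i \<circ> (\<sigma> \<circ> \<tau>)))"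
      by (simp only: mult.assoc o_assoc)
  qed
  also have "\<dots> = of_int (sign \<tau>) * (\<Sum>\<sigma>\<in>?S. of_int (sign \<sigma>) * g (i \<circ> \<sigma>))"
    unfolding sum_distrib_left[symmetric]
    by (simp only: sum_permutations_compose_right[OF \<tau>, of "\<lambda>\<sigma>. of_int (sign \<sigma>) * g (i \<circ> \<sigma>)"])
  also have "(\<Sum>\<sigma>\<in>?S. of_int (sign \<sigma>) * g (i \<circ> \<sigma>)) = (\<Sum>j\<in>multi_indices N. of_real (eps N i j) * g j)"
    by (rule sum_eps[symmetric]) (rule local)
  finally show ?thesis .
qed

section \<open>Cyclic products\<close>

text \<open>A cycle of length n + 1: the parameter is one less than the number of positions
  moved.\<close>

definition rotate_index :: "nat \<Rightarrow> nat \<Rightarrow> nat"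
  where "rotate_index n k = (if 1 \<le> k \<and> k \<le> n then Suc k else if k = Suc n then 1 else k)"

lemma rotate_index_permutes: "rotate_index n permutes {1..Suc n}"
proof (rule bij_imp_permutes)
  have "rotate_index n ` {1..Suc n} = {1..Suc n}"
  proof (rule antisym)
    show "{1..Suc n} \<subseteq> rotate_index n ` {1..Suc n}"
    proof
      fix p assume p: "p \<in> {1..Suc n}"
      show "p \<in> rotate_index n ` {1..Suc n}"
      proof (cases "p = 1")
        case True
        then show ?thesis by (intro image_eqI[of _ _ "Suc n"]) (auto simp: rotate_index_def)
      next
        case False
        with p show ?thesis by (intro image_eqI[of _ _ "p - 1"]) (auto simp: rotate_index_def)
      qed
    qed
  qed (auto simp: rotate_index_def)
  then show "bij_betw (rotate_index n) {1..Suc n} {1..Suc n}"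
    by (auto simp: bij_betw_def intro: eq_card_imp_inj_on)
qed (auto simp: rotate_index_def)

lemma oprod_rotate_index: "oprod (g \<circ> rotate_index n) (Suc n) = oprod (\<lambda>p. g (Suc p)) n * g 1"
proof -
  have "oprod (g \<circ> rotate_index n) n = oprod (\<lambda>p. g (Suc p)) n"
    by (rule oprod_cong) (simp add: rotate_index_def)
  then show ?thesis by (simp add: rotate_index_def)
qed

text \<open>The sign is computed in the exterior algebra over the integers: the rotation moves
  \<open>eta 1\<close> past an even number of generators, which leaves the nonzero top monomial
  unchanged.\<close>

lemma sign_rotate_index: "sign (rotate_index (2 * n)) = 1"
proof -
  let ?r = "rotate_index (2 * n)" and ?E = "oprod eta (Suc (2 * n)) :: int exterior"
  have "of_int (sign ?r) * ?E = oprod (eta \<circ> ?r) (Suc (2 * n))"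
    by (rule oprod_permutes[symmetric]) (rule eta_anticommute, rule rotate_index_permutes)
  also have "\<dots> = eta 1 * oprod (\<lambda>p. eta (Suc p)) (2 * n)"
    unfolding oprod_rotate_index by (rule oprod_even_commute) (rule eta_anticommute)
  also have "\<dots> = ?E"
    by (rule oprod_Suc_shift[symmetric])
  finally have eq: "of_int (sign ?r) * ?E = ?E" .
  have top: "ecoeff ?E {1..Suc (2 * n)} = 1"
    by (rule ecoeff_oprod_eta_top)
  show ?thesis
  proof (cases ?r rule: sign_cases)
    case odd
    with eq have "- ?E = ?E" by (simp only: of_int_minus of_int_1 mult_minus1)
    then have "ecoeff (- ?E) {1..Suc (2 * n)} = ecoeff ?E {1..Suc (2 * n)}"
      by (simp only:)
    then show ?thesis unfolding uminus_exterior.rep_eq top by simp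
  qed
qed

lemma mtrace_oprod_rotate_index:
  fixes g :: "nat \<Rightarrow> ('a::comm_ring_1, 'n::finite) sqmat"
  shows "mtrace (oprod (g \<circ> rotate_index n) (Suc n)) = mtrace (oprod g (Suc n))"
  unfolding oprod_rotate_index oprod_Suc_shift[of g] by (rule mtrace_mult_commute)

text \<open>
  A rotation of an odd number of factors is an even permutation, so a cyclic product may be
  rotated at no cost until the factor of the last index stands last.
\<close>

lemma cyclic_reduction:
  assumes "\<sigma> permutes {1..Suc (2 * n)}"
  obtains \<tau> where "\<tau> permutes {1..2 * n}" "sign \<tau> = sign \<sigma>"
    "\<And>g :: nat \<Rightarrow> ('a::comm_ring_1, 'n::finite) sqmat.
      mtrace (oprod (g \<circ> \<sigma>) (Suc (2 * n))) = mtrace (oprod (g \<circ> \<tau>) (Suc (2 * n)))"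
proof -
  let ?I = "{1..Suc (2 * n)}" and ?r = "rotate_index (2 * n)"
  have perm: "permutation \<rho>" if "\<rho> permutes ?I" for \<rho> :: "nat \<Rightarrow> nat"
    using that by (rule permutes_imp_permutation[rotated]) simp
  have "\<exists>\<tau>. \<tau> permutes {1..2 * n} \<and> sign \<tau> = sign \<sigma> \<and>
      (\<forall>g :: nat \<Rightarrow> ('a, 'n) sqmat. mtrace (oprod (g \<circ> \<sigma>) (Suc (2 * n))) = mtrace (oprod (g \<circ> \<tau>) (Suc (2 * n))))"
    if "\<sigma> permutes ?I" "\<sigma> p = Suc (2 * n)" "p \<in> ?I" for p \<sigma>
    using that
  \<comment> \<open>The induction runs over the distance from the place \<open>p\<close> of the last
    index to the end; composing with the inverse rotation moves that index one place to the
    right.\<close>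
  proof (induction "Suc (2 * n) - p" arbitrary: p \<sigma>)
    case 0
    then have "p = Suc (2 * n)" by simp
    with "0.prems"(2) have fixed: "\<sigma> (Suc (2 * n)) = Suc (2 * n)" by simp
    have "\<sigma> permutes {1..2 * n}"
    proof (rule permutes_superset[OF "0.prems"(1)])
      fix x assume "x \<in> ?I - {1..2 * n}"
      then have "x = Suc (2 * n)" by auto
      with fixed show "\<sigma> x = x" by simp
    qed
    then show ?case by blast
  next
    case (Suc t)
    let ?\<rho> = "\<sigma> \<circ> inv ?r"
    note r = rotate_index_permutes[of "2 * n"]
    have "?\<rho> permutes ?I"
      using permutes_compose[OF permutes_inv[OF r] Suc.prems(1)] .
    moreover have "?\<rho> (Suc p) = Suc (2 * n)"
    proof -
      have "?r p = Suc p" using Suc by (auto simp: rotate_index_def)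
      then have "inv ?r (Suc p) = p" using permutes_inverses(2)[OF r, of p] by simp
      then show ?thesis using Suc.prems(2) by simp
    qed
    moreover have "t = Suc (2 * n) - Suc p" "Suc p \<in> ?I" using Suc by auto
    ultimately obtain \<tau> where \<tau>: "\<tau> permutes {1..2 * n}" "sign \<tau> = sign ?\<rho>"
      "\<And>g :: nat \<Rightarrow> ('a, 'n) sqmat. mtrace (oprod (g \<circ> ?\<rho>) (Suc (2 * n))) = mtrace (oprod (g \<circ> \<tau>) (Suc (2 * n)))"
      using Suc.hyps(1) by blast
    have "sign ?\<rho> = sign \<sigma>"
      using sign_compose[OF perm[OF Suc.prems(1)] perm[OF permutes_inv[OF r]]] sign_inverse[OF perm[OF r]]
        sign_rotate_index[of n] by simp
    moreover have "mtrace (oprod (g \<circ> \<sigma>) (Suc (2 * n))) = mtrace (oprod (g \<circ> ?\<rho>) (Suc (2 * n)))"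
      for g :: "nat \<Rightarrow> ('a, 'n) sqmat"
    proof -
      have "g \<circ> ?\<rho> \<circ> ?r = g \<circ> \<sigma>"
        using permutes_inv_o(2)[OF r] by (simp only: o_assoc[symmetric] comp_id)
      then show ?thesis
        using mtrace_oprod_rotate_index[of "g \<circ> ?\<rho>" "2 * n"] by (simp only:)
    qed
    ultimately show ?case using \<tau> by (intro exI[of _ \<tau>]) (simp only:, simp)
  qed
  moreover have "inv \<sigma> (Suc (2 * n)) \<in> ?I"
    unfolding permutes_in_image[OF permutes_inv[OF assms]] by simp
  ultimately obtain \<tau> where "\<tau> permutes {1..2 * n}" "sign \<tau> = sign \<sigma>"
      "\<forall>g :: nat \<Rightarrow> ('a, 'n) sqmat. mtrace (oprod (g \<circ> \<sigma>) (Suc (2 * n))) = mtrace (oprod (g \<circ> \<tau>) (Suc (2 * n)))"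
    using assms permutes_inverses(1)[OF assms] by blast
  then show ?thesis using that by blast
qed

section \<open>The d-tensors as nested anticommutators\<close>

lemma d_tensor_cong:
  assumes "\<And>p. 1 \<le> p \<Longrightarrow> p \<le> r \<Longrightarrow> l p = l' p"
  shows "d_tensor d r l = d_tensor d r l'"
  using assms
proof (induction d r l arbitrary: l' rule: d_tensor.induct)
  case (5 d r l)
  have "d_tensor d (Suc (Suc (Suc r))) (l(r + 3 := j)) = d_tensor d (Suc (Suc (Suc r))) (l'(r + 3 := j))" for j
  proof (rule "5.IH")
    show "(l(r + 3 := j)) p = (l'(r + 3 := j)) p" if "1 \<le> p" "p \<le> Suc (Suc (Suc r))" for p
      using that "5.prems"[of p] by simp
  qed simp_all
  moreover have "l (r + 3) = l' (r + 3)" "l (r + 4) = l' (r + 4)"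
    by (rule "5.prems"; simp)+
  ultimately show ?case by simp
qed auto

context su_generators
begin

section \<open>The generators and their trace identities\<close>

definition gen :: "'g \<Rightarrow> (complex, 'n) sqmat"
  where "gen a = sqm (T a)"

lemma gen_commutator:
  "(\<Sum>k\<in>UNIV. scal (of_real (C a b k)) * gen k) = scal (- \<i>) * (gen a * gen b - gen b * gen a)"
proof -
  have "gen a * gen b - gen b * gen a = scal \<i> * (\<Sum>k\<in>UNIV. scal (of_real (f a b k)) * gen k)"
    using arg_cong[OF commutator_T[of a b], of sqm]
    by (simp add: sqm_diff sqm_mult sqm_cscale sqm_sum sqm_scaleR gen_def)
  then have "scal (- \<i>) * (gen a * gen b - gen b * gen a)
      = (scal (- \<i>) * scal \<i>) * (\<Sum>k\<in>UNIV. scal (of_real (f a b k)) * gen k)"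
    by (simp only: mult.assoc)
  then show ?thesis
    by (simp add: C_eq_f flip: scal_mult)
qed

lemma gen_anticommutator:
  "(\<Sum>k\<in>UNIV. scal (of_real (d a b k)) * gen k)
    = gen a * gen b + gen b * gen a - scal (of_real (kdelta a b) / of_nat CARD('n))"
proof -
  have "sqm (if a = b then mat (1 / of_nat CARD('n)) else 0)
      = (scal (of_real (kdelta a b) / of_nat CARD('n)) :: (complex, 'n) sqmat)"
    by (simp add: kdelta_def sqm_mat)
  then show ?thesis
    using arg_cong[OF anticommutator_T[of a b], of sqm]
    by (simp add: sqm_add sqm_mult sqm_sum sqm_scaleR gen_def algebra_simps)
qed

lemma mtrace_gen: "mtrace (gen a) = 0"
  by (simp add: gen_def mtrace_sqm traceless_T)

lemma mtrace_gen_gen: "mtrace (gen a * gen b) = of_real (kdelta a b) / 2"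
  by (simp add: gen_def mtrace_sqm trace_T_T kdelta_def flip: sqm_mult)

lemma mtrace_combination:
  "mtrace ((\<Sum>k\<in>UNIV. scal (c k) * gen k) * gen a) = c a / 2"
proof -
  have "mtrace ((\<Sum>k\<in>UNIV. scal (c k) * gen k) * gen a) = (\<Sum>k\<in>UNIV. if k = a then c k / 2 else 0)"
    unfolding sum_distrib_right mtrace_sum mult.assoc mtrace_scal_mult mtrace_gen_gen
    by (rule sum.cong) (auto simp: kdelta_def)
  then show ?thesis by simp
qed

text \<open>Pairing the anticommutator with a third generator isolates \<open>d\<close>: its unit
  part pairs to zero with a traceless matrix, and the 2 inverts the normalisation 1/2.\<close>

lemma d_eq_mtrace:
  "complex_of_real (d a b c) = 2 * mtrace ((gen a * gen b + gen b * gen a) * gen c)"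
proof -
  have "mtrace ((gen a * gen b + gen b * gen a) * gen c)
      = mtrace ((\<Sum>k\<in>UNIV. scal (of_real (d a b k)) * gen k) * gen c)
        + mtrace (scal (of_real (kdelta a b) / of_nat CARD('n)) * gen c)"
    unfolding gen_anticommutator by (simp add: left_diff_distrib flip: mtrace_add)
  then show ?thesis
    by (simp add: mtrace_combination mtrace_scal_mult mtrace_gen mult.commute)
qed

text \<open>Inherited from the cyclicity of the trace. It lets the first index of \<open>d\<close>
  be treated as the open slot of the anticommutation relation.\<close>

lemma d_cyclic: "d a b c = d b c a"
proof -
  have "mtrace ((gen a * gen b + gen b * gen a) * gen c) = mtrace (gen a * gen b * gen c) + mtrace (gen b * gen a * gen c)"
    by (simp add: distrib_right mtrace_add)
  also have "mtrace (gen a * gen b * gen c) = mtrace (gen b * gen c * gen a)"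
    by (simp add: mult.assoc mtrace_mult_commute[of "gen a"])
  also have "mtrace (gen b * gen a * gen c) = mtrace (gen c * gen b * gen a)"
    by (simp add: mult.assoc mtrace_mult_commute[of "gen c"])
  also have "mtrace (gen b * gen c * gen a) + mtrace (gen c * gen b * gen a)
      = mtrace ((gen b * gen c + gen c * gen b) * gen a)"
    by (simp add: distrib_right mtrace_add)
  finally show ?thesis
    using d_eq_mtrace[of a b c] d_eq_mtrace[of b c a] by (metis of_real_eq_iff)
qed

text \<open>
  The d-tensor of order \<open>r + 1\<close> with its last slot open, read as a matrix: passing to the next
  order is then an anticommutator with the trace part removed (\<open>d_vec_Suc\<close>).
\<close>

definition d_vec :: "nat \<Rightarrow> (nat \<Rightarrow> 'g) \<Rightarrow> (complex, 'n) sqmat"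
  where "d_vec r l = (\<Sum>k\<in>UNIV. scal (of_real (d_tensor d (Suc r) (l(Suc r := k)))) * gen k)"

lemma d_vec_upd [simp]: "d_vec r (l(Suc r := a)) = d_vec r l"
  by (simp add: d_vec_def)

lemma d_vec_1: "d_vec (Suc 0) l = gen (l 1)"
proof -
  have "d_vec (Suc 0) l = (\<Sum>k\<in>UNIV. if k = l 1 then gen k else 0)"
    unfolding d_vec_def by (rule sum.cong) (auto simp: kdelta_def)
  then show ?thesis by simp
qed

lemma d_tensor_eq_mtrace:
  "complex_of_real (d_tensor d (Suc r) l) = 2 * mtrace (d_vec r l * gen (l (Suc r)))"
  by (simp add: d_vec_def mtrace_combination)

lemma d_vec_Suc:
  assumes "1 \<le> r"
  shows "d_vec (Suc r) l = d_vec r l * gen (l (Suc r)) + gen (l (Suc r)) * d_vec r l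
    - scal (of_real (d_tensor d (Suc r) l) / of_nat CARD('n))"
\<comment> \<open>The recursion for \<open>d_tensor\<close> starts at order 3; the step from order 2
  to order 3 is the anticommutation relation itself.\<close>
proof (cases "r = 1")
  case True
  then show ?thesis
    using gen_anticommutator[of "l 1" "l 2"]
    by (simp add: d_vec_1) (simp add: d_vec_def numeral_2_eq_2)
next
  case False
  with assms have r: "Suc r \<ge> 3" by simp
  let ?a = "l (Suc r)" and ?n = "of_nat CARD('n) :: complex"
  let ?t = "\<lambda>j. complex_of_real (d_tensor d (Suc r) (l(Suc r := j)))"
  have "complex_of_real (d_tensor d (Suc (Suc r)) (l(Suc (Suc r) := k)))
      = (\<Sum>j\<in>UNIV. ?t j * of_real (d j ?a k))" for k
  proof -
    have "d_tensor d (Suc r) (l(Suc (Suc r) := k, Suc r := j)) = d_tensor d (Suc r) (l(Suc r := j))" for j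
      by (rule d_tensor_cong) auto
    then show ?thesis
      using d_tensor_rec[OF r, of d "l(Suc (Suc r) := k)"] by simp
  qed
  then have "d_vec (Suc r) l
      = (\<Sum>k\<in>UNIV. \<Sum>j\<in>UNIV. scal (?t j) * (scal (of_real (d j ?a k)) * gen k))"
    by (simp add: d_vec_def scal_sum scal_mult sum_distrib_right mult.assoc)
  also have "\<dots> = (\<Sum>j\<in>UNIV. scal (?t j) * (\<Sum>k\<in>UNIV. scal (of_real (d j ?a k)) * gen k))"
    unfolding sum_distrib_left by (rule sum.swap)
  also have "\<dots> = (\<Sum>j\<in>UNIV. scal (?t j) * gen j) * gen ?a + gen ?a * (\<Sum>j\<in>UNIV. scal (?t j) * gen j)
      - (\<Sum>j\<in>UNIV. scal (?t j) * scal (of_real (kdelta j ?a) / ?n))"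
  proof -
    have "gen ?a * (scal (?t j) * gen j) = scal (?t j) * (gen ?a * gen j)" for j
      using scal_commute[of "?t j" "gen ?a"] by (simp flip: mult.assoc)
    then show ?thesis
      by (simp add: gen_anticommutator right_diff_distrib distrib_left sum.distrib sum_subtractf
          sum_distrib_left sum_distrib_right mult.assoc)
  qed
  \<comment> \<open>The Kronecker delta closes the open slot with \<open>l (Suc r)\<close>, which
    gives back the tensor of order r + 1.\<close>
  also have "(\<Sum>j\<in>UNIV. scal (?t j) * scal (of_real (kdelta j ?a) / ?n))
      = (\<Sum>j\<in>UNIV. if j = ?a then scal (?t j / ?n) else 0 :: (complex, 'n) sqmat)"
    by (rule sum.cong) (auto simp: kdelta_def simp flip: scal_mult)
  finally show ?thesis
    by (simp only: d_vec_def sum.delta finite UNIV_I if_True fun_upd_triv)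
qed

section \<open>Contraction of the d-tensors with forms\<close>

definition vec_form :: "('g \<Rightarrow> (complex, 'n) sqmat exterior) \<Rightarrow> (complex, 'n) sqmat exterior"
  where "vec_form \<psi> = (\<Sum>a\<in>UNIV. \<psi> a * const (gen a))"

lemma vec_form_mult_vec_form:
  assumes "\<And>b. scalar_form (\<psi> b)"
  shows "vec_form \<phi> * vec_form \<psi> = (\<Sum>a\<in>UNIV. \<Sum>b\<in>UNIV. \<phi> a * \<psi> b * const (gen a * gen b))"
proof -
  have "\<phi> a * const (gen a) * (\<psi> b * const (gen b)) = \<phi> a * \<psi> b * const (gen a * gen b)" for a b
  proof -
    have "\<phi> a * const (gen a) * (\<psi> b * const (gen b)) = \<phi> a * (const (gen a) * \<psi> b) * const (gen b)"
      by (simp only: mult.assoc)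
    also have "const (gen a) * \<psi> b = \<psi> b * const (gen a)"
      using assms by (rule const_scalar_form_commute)
    finally show ?thesis by (simp only: const_mult mult.assoc)
  qed
  then show ?thesis
    unfolding vec_form_def sum_product by (simp only:)
qed

text \<open>The tensor of order r + 1 with \<open>\<omega> p\<close> in slot p and its last slot
  open. By \<open>jordan_form_Suc\<close> this is an iterated Jordan product of the
  \<open>vec_form (\<omega> p)\<close> with the trace removed at each stage.\<close>

definition jordan_form :: "(nat \<Rightarrow> 'g \<Rightarrow> (complex, 'n) sqmat exterior) \<Rightarrow> nat \<Rightarrow> (complex, 'n) sqmat exterior"
  where "jordan_form \<omega> r = (\<Sum>l\<in>multi_indices r. oprod (\<lambda>p. \<omega> p (l p)) r * const (d_vec r l))"

lemma jordan_form_1: "jordan_form \<omega> 1 = vec_form (\<omega> 1)"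
  by (simp add: jordan_form_def vec_form_def sum_multi_indices_Suc d_vec_1)
    (simp add: multi_indices_def)

lemma jordan_form_mult_vec_form:
  assumes "\<And>p a. scalar_form (\<omega> p a)"
  shows "jordan_form \<omega> r * vec_form (\<omega> (Suc r)) = (\<Sum>l\<in>multi_indices (Suc r).
    oprod (\<lambda>p. \<omega> p (l p)) (Suc r) * const (d_vec r l * gen (l (Suc r))))"
proof -
  have "oprod (\<lambda>p. \<omega> p (l p)) r * const (d_vec r l) * (\<omega> (Suc r) a * const (gen a))
      = oprod (\<lambda>p. \<omega> p (l p)) r * \<omega> (Suc r) a * const (d_vec r l * gen a)" for l a
    using const_scalar_form_commute[OF assms, of "d_vec r l" "Suc r" a]
    by (simp add: const_mult mult.assoc) (simp flip: mult.assoc)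
  then show ?thesis
    unfolding jordan_form_def vec_form_def sum_multi_indices_Suc sum_distrib_left sum_distrib_right
    by (simp only: oprod.simps oprod_upd d_vec_upd fun_upd_same) (rule sum.swap)
qed

text \<open>Commutation is asked of distinct slots only, since components of the odd form
  anticommute among themselves; the new factor passes none but the other slots.\<close>

lemma vec_form_mult_jordan_form:
  assumes scalar: "\<And>p a. scalar_form (\<omega> p a)"
    and comm: "\<And>p q a b. p \<noteq> q \<Longrightarrow> \<omega> p a * \<omega> q b = \<omega> q b * \<omega> p a"
  shows "vec_form (\<omega> (Suc r)) * jordan_form \<omega> r = (\<Sum>l\<in>multi_indices (Suc r).
    oprod (\<lambda>p. \<omega> p (l p)) (Suc r) * const (gen (l (Suc r)) * d_vec r l))"
proof -
  have "\<omega> (Suc r) a * const (gen a) * (oprod (\<lambda>p. \<omega> p (l p)) r * const (d_vec r l))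
      = oprod (\<lambda>p. \<omega> p (l p)) r * \<omega> (Suc r) a * const (gen a * d_vec r l)" for l a
  proof -
    let ?P = "oprod (\<lambda>p. \<omega> p (l p)) r"
    have "\<omega> (Suc r) a * const (gen a) * (?P * const (d_vec r l))
        = \<omega> (Suc r) a * (const (gen a) * ?P) * const (d_vec r l)"
      by (simp only: mult.assoc)
    also have "const (gen a) * ?P = ?P * const (gen a)"
      by (intro const_scalar_form_commute scalar_form_oprod scalar)
    also have "\<omega> (Suc r) a * (?P * const (gen a)) * const (d_vec r l)
        = \<omega> (Suc r) a * ?P * (const (gen a) * const (d_vec r l))"
      by (simp only: mult.assoc)
    also have "\<omega> (Suc r) a * ?P = ?P * \<omega> (Suc r) a"
      by (rule oprod_commute[symmetric]) (rule comm, simp)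
    finally show ?thesis by (simp only: const_mult)
  qed
  then show ?thesis
    unfolding jordan_form_def vec_form_def sum_multi_indices_Suc sum_distrib_left sum_distrib_right
    by (simp only: oprod.simps oprod_upd d_vec_upd fun_upd_same)
qed

text \<open>Closing the last slot amounts to pairing with a generator under the trace; the 2 inverts
  the normalisation 1/2.\<close>

lemma d_tensor_form_eq_ftrace:
  assumes "\<And>p a. scalar_form (\<omega> p a)"
  shows "(\<Sum>l\<in>multi_indices (Suc r). oprod (\<lambda>p. \<omega> p (l p)) (Suc r)
      * cform (of_real (d_tensor d (Suc r) l)))
    = cform 2 * ftrace (jordan_form \<omega> r * vec_form (\<omega> (Suc r)))"
proof -
  have "ftrace (oprod (\<lambda>p. \<omega> p (l p)) (Suc r) * X) = oprod (\<lambda>p. \<omega> p (l p)) (Suc r) * ftrace X" for l X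
    by (intro ftrace_scalar_mult scalar_form_oprod assms)
  then have "ftrace (jordan_form \<omega> r * vec_form (\<omega> (Suc r))) = (\<Sum>l\<in>multi_indices (Suc r).
      oprod (\<lambda>p. \<omega> p (l p)) (Suc r) * cform (mtrace (d_vec r l * gen (l (Suc r)))))"
    by (simp only: jordan_form_mult_vec_form[of \<omega> r, OF assms] ftrace_sum ftrace_const)
  then show ?thesis
    by (simp only: d_tensor_eq_mtrace cform_mult cform_left_commute sum_distrib_left)
qed

text \<open>In the constant 2/n, the 1/n belongs to the unit part of the anticommutator and the 2 to
  the conversion of the d-tensor into a trace.\<close>

lemma jordan_form_Suc:
  assumes "\<And>p a. scalar_form (\<omega> p a)"
    and "\<And>p q a b. p \<noteq> q \<Longrightarrow> \<omega> p a * \<omega> q b = \<omega> q b * \<omega> p a" and "1 \<le> r"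
  shows "jordan_form \<omega> (Suc r) = jordan_form \<omega> r * vec_form (\<omega> (Suc r))
    + vec_form (\<omega> (Suc r)) * jordan_form \<omega> r
    - cform (2 / of_nat CARD('n)) * ftrace (jordan_form \<omega> r * vec_form (\<omega> (Suc r)))"
proof -
  let ?P = "\<lambda>l. oprod (\<lambda>p. \<omega> p (l p)) (Suc r)"
  have commuted: "vec_form (\<omega> (Suc r)) * jordan_form \<omega> r
      = (\<Sum>l\<in>multi_indices (Suc r). ?P l * const (gen (l (Suc r)) * d_vec r l))"
    by (rule vec_form_mult_jordan_form) (fact assms)+
  have "jordan_form \<omega> (Suc r) = (\<Sum>l\<in>multi_indices (Suc r). ?P l * const (d_vec r l * gen (l (Suc r)))
      + ?P l * const (gen (l (Suc r)) * d_vec r l)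
      - cform (1 / of_nat CARD('n)) * (?P l * cform (of_real (d_tensor d (Suc r) l))))"
    unfolding jordan_form_def
  proof (rule sum.cong[OF refl])
    fix l :: "nat \<Rightarrow> 'g"
    have "const (d_vec (Suc r) l) = const (d_vec r l * gen (l (Suc r))) + const (gen (l (Suc r)) * d_vec r l)
        - cform (1 / of_nat CARD('n)) * cform (of_real (d_tensor d (Suc r) l))"
      unfolding d_vec_Suc[OF \<open>1 \<le> r\<close>]
      by (simp add: algebra_simps cform_def flip: const_add const_mult scal_mult)
    then show "?P l * const (d_vec (Suc r) l) = ?P l * const (d_vec r l * gen (l (Suc r)))
      + ?P l * const (gen (l (Suc r)) * d_vec r l)
      - cform (1 / of_nat CARD('n)) * (?P l * cform (of_real (d_tensor d (Suc r) l)))"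
      by (simp only: right_diff_distrib distrib_left cform_left_commute)
  qed
  also have "\<dots> = jordan_form \<omega> r * vec_form (\<omega> (Suc r)) + vec_form (\<omega> (Suc r)) * jordan_form \<omega> r
    - cform (1 / of_nat CARD('n)) * (cform 2 * ftrace (jordan_form \<omega> r * vec_form (\<omega> (Suc r))))"
    by (simp only: sum_subtractf sum.distrib sum_distrib_left[symmetric]
        d_tensor_form_eq_ftrace[of \<omega> r, OF assms(1)] jordan_form_mult_vec_form[of \<omega> r, OF assms(1), symmetric]
        commuted[symmetric])
  finally show ?thesis
    by (simp flip: mult.assoc cform_mult)
qed

end

section \<open>Chains of trace-free anticommutators with one odd entry\<close>

lemma jordan_chain_even:
  fixes F :: "(complex, 'n::finite) sqmat exterior"
  assumes J1: "J 1 = V 1"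
    and J: "\<And>r. 1 \<le> r \<Longrightarrow> J (Suc r) = J r * V (Suc r) + V (Suc r) * J r - cform c * ftrace (J r * V (Suc r))"
    and V: "\<And>p. p \<noteq> q \<Longrightarrow> V p = F"
    and trF: "\<And>k. 1 \<le> k \<Longrightarrow> ftrace (F ^ k) = 0"
    and "1 \<le> r" "r < q"
  shows "J r = cform (2 ^ (r - 1)) * F ^ r"
  using \<open>1 \<le> r\<close> \<open>r < q\<close>
proof (induction r rule: dec_induct)
  case base
  then show ?case using V[of 1] J1 by simp
next
  case (step r)
  then have IH: "J r = cform (2 ^ (r - 1)) * F ^ r" and V': "V (Suc r) = F"
    using V by simp_all
  have JV: "J r * V (Suc r) = cform (2 ^ (r - 1)) * F ^ Suc r"
    and VJ: "V (Suc r) * J r = cform (2 ^ (r - 1)) * F ^ Suc r"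
    by (simp_all add: IH V' cform_left_commute mult.assoc power_commutes)
  \<comment> \<open>The two products of the anticommutator agree, which doubles the factor, and the
    trace part is a multiple of the trace of a power of \<open>F\<close>.\<close>
  have "J (Suc r) = cform (2 ^ (r - 1)) * F ^ Suc r + cform (2 ^ (r - 1)) * F ^ Suc r"
    unfolding J[OF step.hyps(1)] JV VJ ftrace_cform_mult by (simp only: trF le_add1 plus_1_eq_Suc mult_zero_right diff_zero)
  also have "\<dots> = cform (2 ^ (r - 1) + 2 ^ (r - 1)) * F ^ Suc r"
    by (simp only: cform_add distrib_right)
  also have "2 ^ (r - 1) + 2 ^ (r - 1) = (2 ^ (Suc r - 1) :: complex)"
    using step.hyps(1) by (cases r) simp_all
  finally show ?case .
qed

text \<open>Once the odd entry has been met, trace parts need not vanish. They are gathered in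
  \<open>R\<close>, whose value is irrelevant: commuting with \<open>F\<close> and having traceless
  products with positive powers of \<open>F\<close> is preserved by further steps and is enough for
  the final trace.\<close>

lemma jordan_chain_odd:
  fixes F :: "(complex, 'n::finite) sqmat exterior"
  assumes J1: "J 1 = V 1"
    and J: "\<And>r. 1 \<le> r \<Longrightarrow> J (Suc r) = J r * V (Suc r) + V (Suc r) * J r - cform c * ftrace (J r * V (Suc r))"
    and V: "\<And>p. p \<noteq> q \<Longrightarrow> V p = F" and Vq: "V q = \<theta>"
    and trF: "\<And>k. 1 \<le> k \<Longrightarrow> ftrace (F ^ k) = 0"
    and F: "homog False F" and comm: "\<theta> * F = F * \<theta>"
    and "1 \<le> q" "q \<le> r"
  shows "\<exists>R. J r = cform (2 ^ (r - 1)) * (F ^ (r - 1) * \<theta>) - R \<and> R * F = F * R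
    \<and> (\<forall>k\<ge>1. ftrace (R * F ^ k) = 0)"
  using \<open>q \<le> r\<close>
proof (induction r rule: dec_induct)
  case base
  show ?case
  proof (cases "q = 1")
    case True
    then show ?thesis by (intro exI[of _ 0]) (use J1 Vq in simp)
  next
    case False
    then obtain r where q: "q = Suc r" and "1 \<le> r" using \<open>1 \<le> q\<close> by (cases q) auto
    let ?R = "cform c * ftrace (J r * \<theta>)"
    have scalar: "scalar_form ?R" by (intro scalar_form_mult) simp_all
    have "r < q" by (simp add: q)
    with J1 J V trF \<open>1 \<le> r\<close> have "J r = cform (2 ^ (r - 1)) * F ^ r"
      by (rule jordan_chain_even)
    then have "J r * \<theta> + \<theta> * J r = cform (2 ^ (r - 1)) * (F ^ r * \<theta>) + cform (2 ^ (r - 1)) * (F ^ r * \<theta>)"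
      using power_commuting_commutes[OF comm[symmetric], of r]
      by (simp add: cform_left_commute mult.assoc)
    also have "\<dots> = cform (2 ^ (r - 1) + 2 ^ (r - 1)) * (F ^ r * \<theta>)"
      by (simp only: cform_add distrib_right)
    also have "2 ^ (r - 1) + 2 ^ (r - 1) = (2 ^ (q - 1) :: complex)"
      using \<open>1 \<le> r\<close> by (cases r) (simp_all add: q)
    finally have "J q = cform (2 ^ (q - 1)) * (F ^ (q - 1) * \<theta>) - ?R"
      using J[OF \<open>1 \<le> r\<close>] Vq by (simp add: q)
    moreover have "?R * F = F * ?R"
      using scalar F by (intro scalar_form_commute) simp_all
    moreover have "ftrace (?R * F ^ k) = 0" if "1 \<le> k" for k
      using scalar trF[OF that] by (simp add: ftrace_scalar_mult del: scalar_form_ftrace)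
    ultimately show ?thesis by blast
  qed
next
  case (step r)
  then obtain R where R: "J r = cform (2 ^ (r - 1)) * (F ^ (r - 1) * \<theta>) - R" "R * F = F * R"
      "\<And>k. 1 \<le> k \<Longrightarrow> ftrace (R * F ^ k) = 0"
    by blast
  have r: "1 \<le> r" "Suc (r - 1) = r" using \<open>1 \<le> q\<close> step.hyps by simp_all
  \<comment> \<open>The new trace part; the remainder passes from \<open>R\<close> to
    \<open>R * F + R * F + ?s\<close>.\<close>
  let ?s = "cform c * ftrace (J r * F)" and ?X = "cform (2 ^ (r - 1)) * (F ^ r * \<theta>)"
  have scalar: "scalar_form ?s" by (intro scalar_form_mult) simp_all
  have FX: "F ^ (r - 1) * \<theta> * F = F ^ r * \<theta>" "F * (F ^ (r - 1) * \<theta>) = F ^ r * \<theta>"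
  proof -
    have F: "F ^ (r - 1) * F = F ^ r" "F * F ^ (r - 1) = F ^ r"
      using power_Suc2[of F "r - 1"] power_Suc[of F "r - 1"] unfolding r(2) by (simp_all only:)
    have "F ^ (r - 1) * \<theta> * F = F ^ (r - 1) * F * \<theta>"
      by (simp only: mult.assoc comm)
    then show "F ^ (r - 1) * \<theta> * F = F ^ r * \<theta>"
      by (simp only: F)
    show "F * (F ^ (r - 1) * \<theta>) = F ^ r * \<theta>"
      by (simp only: F mult.assoc[symmetric])
  qed
  have "J r * F + F * J r = ?X + ?X - (R * F + R * F)"
    unfolding R(1) left_diff_distrib right_diff_distrib cform_left_commute mult.assoc[of "cform _"] FX R(2)
    by simp
  also have "?X + ?X = cform (2 ^ (r - 1) + 2 ^ (r - 1)) * (F ^ r * \<theta>)"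
    by (simp only: cform_add distrib_right)
  also have "2 ^ (r - 1) + 2 ^ (r - 1) = (2 ^ (Suc r - 1) :: complex)"
    using r(1) by (cases r) simp_all
  finally have "J (Suc r) = cform (2 ^ (Suc r - 1)) * (F ^ (Suc r - 1) * \<theta>) - (R * F + R * F + ?s)"
    using J[OF r(1)] V[of "Suc r"] step.hyps by simp
  moreover have "?s * F = F * ?s"
    using scalar F by (intro scalar_form_commute) simp_all
  then have "(R * F + R * F + ?s) * F = F * (R * F + R * F + ?s)"
    by (simp only: distrib_left distrib_right R(2) mult.assoc)
  moreover have "ftrace ((R * F + R * F + ?s) * F ^ k) = 0" if "1 \<le> k" for k
  proof -
    have "ftrace (?s * F ^ k) = 0"
      by (simp only: ftrace_scalar_mult[OF scalar] trF[OF that] mult_zero_right)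
    then show ?thesis
      using R(3)[of "Suc k"] by (simp add: distrib_right ftrace_add mult.assoc)
  qed
  ultimately show ?case by blast
qed

text \<open>
  The trace parts split off after the odd entry \<open>\<theta>\<close> are scalars, later multiplied by powers of \<open>F\<close>
  only, and the traces of these vanish: hence the position \<open>q\<close> of \<open>\<theta>\<close> does not matter.
\<close>

lemma ftrace_jordan_chain:
  fixes F :: "(complex, 'n::finite) sqmat exterior"
  assumes J1: "J 1 = V 1"
    and J: "\<And>r. 1 \<le> r \<Longrightarrow> J (Suc r) = J r * V (Suc r) + V (Suc r) * J r - cform c * ftrace (J r * V (Suc r))"
    and V: "\<And>p. p \<noteq> q \<Longrightarrow> V p = F" and Vq: "V q = \<theta>"
    and trF: "\<And>k. 1 \<le> k \<Longrightarrow> ftrace (F ^ k) = 0"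
    and F: "homog False F" and comm: "\<theta> * F = F * \<theta>"
    and "1 \<le> r" "1 \<le> q" "q \<le> Suc r"
  shows "ftrace (J r * V (Suc r)) = cform (2 ^ (r - 1)) * ftrace (F ^ r * \<theta>)"
proof (cases "q = Suc r")
  case True
  then have "r < q" by simp
  with J1 J V trF \<open>1 \<le> r\<close> have "J r = cform (2 ^ (r - 1)) * F ^ r"
    by (rule jordan_chain_even)
  then show ?thesis
    using Vq True by (simp add: mult.assoc ftrace_cform_mult)
next
  case False
  with \<open>q \<le> Suc r\<close> have "q \<le> r" by simp
  obtain R where R: "J r = cform (2 ^ (r - 1)) * (F ^ (r - 1) * \<theta>) - R" "ftrace (R * F ^ 1) = 0"
    using jordan_chain_odd[OF J1 J V Vq trF F comm \<open>1 \<le> q\<close> \<open>q \<le> r\<close>] by blast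
  have "F ^ (r - 1) * \<theta> * F = F ^ r * \<theta>"
    using power_Suc2[of F "r - 1"] \<open>1 \<le> r\<close> comm by (simp add: mult.assoc)
  then show ?thesis
    using R V[of "Suc r"] False by (simp add: left_diff_distrib ftrace_diff mult.assoc ftrace_cform_mult)
qed

section \<open>The cocycles as alternated traces\<close>

context su_generators
begin

definition theta :: "(nat \<Rightarrow> 'g) \<Rightarrow> nat \<Rightarrow> (complex, 'n) sqmat exterior"
  where "theta i N = vec_form (dual_form i N)"

text \<open>The components of F; the matrix-valued form itself is
  \<open>vec_form (curv i N)\<close>.\<close>

definition curv :: "(nat \<Rightarrow> 'g) \<Rightarrow> nat \<Rightarrow> 'g \<Rightarrow> (complex, 'n) sqmat exterior"
  where "curv i N l = (\<Sum>a\<in>UNIV. \<Sum>b\<in>UNIV. dual_form i N a * dual_form i N b * cform (of_real (C a b l)))"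

lemma scalar_form_curv [simp]: "scalar_form (curv i N l)"
  unfolding curv_def by (intro scalar_form_sum scalar_form_mult) simp_all

lemma homog_curv [simp]: "homog False (curv i N l)"
proof -
  have "homog False (dual_form i N a * dual_form i N b * cform c :: (complex, 'n) sqmat exterior)" for a b c
    using homog_mult[OF homog_mult[OF homog_dual_form[of i N a] homog_dual_form[of i N b]] homog_cform[of c]]
    by simp
  then show ?thesis
    unfolding curv_def by (intro homog_sum)
qed

lemma homog_theta: "homog True (theta i N)"
  unfolding theta_def vec_form_def by (intro homog_sum homog_mult[of True _ False, simplified]) simp_all

lemma theta_mult_theta:
  "theta i N * theta i N
    = (\<Sum>a\<in>UNIV. \<Sum>b\<in>UNIV. dual_form i N a * dual_form i N b * const (gen a * gen b))"
  unfolding theta_def by (rule vec_form_mult_vec_form) simp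

lemma theta_mult_theta_swapped:
  "theta i N * theta i N
    = - (\<Sum>a\<in>UNIV. \<Sum>b\<in>UNIV. dual_form i N a * dual_form i N b * const (gen b * gen a))"
proof -
  have "dual_form i N b * dual_form i N a * const (gen b * gen a)
      = - (dual_form i N a * dual_form i N b * const (gen b * gen a))" for a b
    by (subst scalar_form_anticommute[of "dual_form i N b" "dual_form i N a"]) (simp_all only: scalar_form_dual_form homog_dual_form mult_minus_left)
  then show ?thesis
    unfolding theta_mult_theta sum_negf[symmetric] by (subst sum.swap) (intro sum.cong refl)
qed

text \<open>The commutator contributes -i. Since the dual forms anticommute, each of its two terms
  yields the square of \<open>theta\<close>, which accounts for the 2.\<close>

lemma vec_form_curv: "vec_form (curv i N) = cform (- 2 * \<i>) * (theta i N * theta i N)"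
proof -
  let ?\<theta> = "dual_form i N :: 'g \<Rightarrow> (complex, 'n) sqmat exterior"
  have "vec_form (curv i N)
      = (\<Sum>l\<in>UNIV. \<Sum>a\<in>UNIV. \<Sum>b\<in>UNIV. ?\<theta> a * ?\<theta> b * const (scal (of_real (C a b l)) * gen l))"
    by (simp add: vec_form_def curv_def sum_distrib_right mult.assoc const_mult flip: cform_def)
  also have "\<dots> = (\<Sum>a\<in>UNIV. \<Sum>b\<in>UNIV. \<Sum>l\<in>UNIV. ?\<theta> a * ?\<theta> b * const (scal (of_real (C a b l)) * gen l))"
    by (subst sum.swap) (rule sum.cong[OF refl], rule sum.swap)
  also have "\<dots> = (\<Sum>a\<in>UNIV. \<Sum>b\<in>UNIV. ?\<theta> a * ?\<theta> b * const (scal (- \<i>) * (gen a * gen b - gen b * gen a)))"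
    by (simp only: sum_distrib_left[symmetric] const_sum[symmetric] gen_commutator)
  also have "\<dots> = (\<Sum>a\<in>UNIV. \<Sum>b\<in>UNIV. cform (- \<i>) * (?\<theta> a * ?\<theta> b * const (gen a * gen b))
      - cform (- \<i>) * (?\<theta> a * ?\<theta> b * const (gen b * gen a)))"
  proof (intro sum.cong refl)
    fix a b
    show "?\<theta> a * ?\<theta> b * const (scal (- \<i>) * (gen a * gen b - gen b * gen a))
      = cform (- \<i>) * (?\<theta> a * ?\<theta> b * const (gen a * gen b))
      - cform (- \<i>) * (?\<theta> a * ?\<theta> b * const (gen b * gen a))"
      by (simp only: const_mult[of "scal _"] const_diff cform_def[symmetric] cform_left_commute right_diff_distrib)
  qed
  also have "\<dots> = cform (- \<i>) * (theta i N * theta i N) + cform (- \<i>) * (theta i N * theta i N)"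
  proof -
    have "(\<Sum>a\<in>UNIV. \<Sum>b\<in>UNIV. ?\<theta> a * ?\<theta> b * const (gen b * gen a)) = - (theta i N * theta i N)"
      using theta_mult_theta_swapped[of i N] by simp
    then show ?thesis
      by (simp only: sum_subtractf sum_distrib_left[symmetric] theta_mult_theta[symmetric]
          mult_minus_right diff_minus_eq_add)
  qed
  also have "\<dots> = cform (- 2 * \<i>) * (theta i N * theta i N)"
    by (simp flip: distrib_right cform_add)
  finally show ?thesis .
qed

lemma homog_theta_sq: "homog False (theta i N * theta i N)"
  using homog_mult[OF homog_theta[of i N] homog_theta[of i N]] by simp

lemma theta_even_power: "theta i N ^ (2 * k) = (theta i N * theta i N) ^ k"
  by (simp add: power_mult power2_eq_square)

text \<open>By graded cyclicity, moving one \<open>theta\<close> past the remaining odd power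
  changes the sign of the trace but not the product.\<close>

lemma ftrace_theta_even_power:
  assumes "1 \<le> k"
  shows "ftrace (theta i N ^ (2 * k)) = 0"
proof -
  obtain m where k: "k = Suc m" using assms by (cases k) auto
  let ?\<theta> = "theta i N"
  have k2: "2 * k = Suc (Suc (2 * m))" by (simp add: k)
  have left: "?\<theta> ^ (2 * k) = ?\<theta> * ?\<theta> ^ Suc (2 * m)"
    unfolding k2 by (rule power_Suc)
  have right: "?\<theta> ^ (2 * k) = ?\<theta> ^ Suc (2 * m) * ?\<theta>"
    unfolding k2 by (rule power_Suc2)
  have "homog (True \<noteq> False) (?\<theta> * (?\<theta> * ?\<theta>) ^ m)"
    by (intro homog_mult homog_theta homog_power_even homog_theta_sq)
  then have "homog True (?\<theta> ^ Suc (2 * m))"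
    by (simp only: power_Suc theta_even_power simp_thms)
  then have "ftrace (?\<theta> * ?\<theta> ^ Suc (2 * m)) = - ftrace (?\<theta> ^ Suc (2 * m) * ?\<theta>)"
    by (rule ftrace_mult_anticommute[OF homog_theta])
  then have "ftrace (?\<theta> ^ (2 * k)) = - ftrace (?\<theta> ^ (2 * k))"
    by (simp only: left[symmetric] right[symmetric])
  then show ?thesis by (rule form_eq_neg_self)
qed

lemma vec_form_curv_power:
  "vec_form (curv i N) ^ k = cform ((- 2 * \<i>) ^ k) * theta i N ^ (2 * k)"
  unfolding vec_form_curv cform_mult_power theta_even_power ..

lemma ftrace_vec_form_curv_power: "1 \<le> k \<Longrightarrow> ftrace (vec_form (curv i N) ^ k) = 0"
  by (simp add: vec_form_curv_power ftrace_cform_mult ftrace_theta_even_power)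

lemma homog_vec_form_curv: "homog False (vec_form (curv i N))"
  unfolding vec_form_def by (intro homog_sum homog_mult[of False _ False, simplified]) simp_all

lemma theta_commute_curv: "theta i N * vec_form (curv i N) = vec_form (curv i N) * theta i N"
  unfolding vec_form_curv cform_left_commute[of "theta i N"] by (simp only: mult.assoc)

text \<open>The index pairs of different structure constants are disjoint and consecutive, so the
  contraction factorises into blocks of two dual forms, in the order in which they stand.\<close>

lemma oprod_curv:
  "(\<Sum>j\<in>multi_indices (2 * M). oprod (\<lambda>p. dual_form i N (j p)) (2 * M)
      * cform (\<Prod>k=1..M. of_real (C (j (2 * k - 1)) (j (2 * k)) (l k))))
    = oprod (\<lambda>k. curv i N (l k)) M"
proof (induction M)
  case 0
  then show ?case by (simp add: multi_indices_def)
next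
  case (Suc M)
  let ?\<theta> = "dual_form i N :: 'g \<Rightarrow> (complex, 'n) sqmat exterior"
  let ?P = "\<lambda>M j. \<Prod>k=1..M. complex_of_real (C (j (2 * k - 1)) (j (2 * k)) (l k))"
  have P: "?P (Suc M) (j(Suc (2 * M) := a, Suc (Suc (2 * M)) := b)) = ?P M j * of_real (C a b (l (Suc M)))"
    for j a b
  proof -
    have "?P M (j(Suc (2 * M) := a, Suc (Suc (2 * M)) := b)) = ?P M j"
      by (rule prod.cong) auto
    then show ?thesis by simp
  qed
  have O: "oprod (\<lambda>p. ?\<theta> ((j(Suc (2 * M) := a, Suc (Suc (2 * M)) := b)) p)) (Suc (Suc (2 * M)))
      = oprod (\<lambda>p. ?\<theta> (j p)) (2 * M) * (?\<theta> a * ?\<theta> b)" for j a b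
  proof -
    have "oprod (\<lambda>p. ?\<theta> ((j(Suc (2 * M) := a, Suc (Suc (2 * M)) := b)) p)) (2 * M)
        = oprod (\<lambda>p. ?\<theta> (j p)) (2 * M)"
      by (rule oprod_cong) simp
    then show ?thesis by (simp add: mult.assoc)
  qed
  have "(\<Sum>j\<in>multi_indices (2 * Suc M). oprod (\<lambda>p. ?\<theta> (j p)) (2 * Suc M) * cform (?P (Suc M) j))
      = (\<Sum>j\<in>multi_indices (2 * M). \<Sum>a\<in>UNIV. \<Sum>b\<in>UNIV.
          oprod (\<lambda>p. ?\<theta> (j p)) (2 * M) * (?\<theta> a * ?\<theta> b) * cform (?P M j * of_real (C a b (l (Suc M)))))"
    by (simp only: mult_Suc_right add_2_eq_Suc sum_multi_indices_Suc P O)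
  also have "\<dots> = (\<Sum>j\<in>multi_indices (2 * M). \<Sum>a\<in>UNIV. \<Sum>b\<in>UNIV.
          oprod (\<lambda>p. ?\<theta> (j p)) (2 * M) * cform (?P M j) * (?\<theta> a * ?\<theta> b * cform (of_real (C a b (l (Suc M))))))"
  proof (intro sum.cong refl)
    fix j :: "nat \<Rightarrow> 'g" and a b
    show "oprod (\<lambda>p. ?\<theta> (j p)) (2 * M) * (?\<theta> a * ?\<theta> b) * cform (?P M j * of_real (C a b (l (Suc M))))
      = oprod (\<lambda>p. ?\<theta> (j p)) (2 * M) * cform (?P M j) * (?\<theta> a * ?\<theta> b * cform (of_real (C a b (l (Suc M)))))"
      using cform_commute[of "?\<theta> a * ?\<theta> b" "?P M j"] by (simp add: cform_mult mult.assoc) (simp flip: mult.assoc)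
  qed
  also have "\<dots> = oprod (\<lambda>k. curv i N (l k)) M * curv i N (l (Suc M))"
    by (simp only: sum_distrib_left[symmetric] curv_def[symmetric] sum_distrib_right[symmetric] Suc.IH)
  finally show ?case by simp
qed

text \<open>The filling of the d-tensor in a cocycle: the odd form in slot \<open>q\<close> and even
  two-forms elsewhere. Of two distinct slots at least one is even, hence they commute.\<close>

definition slot_form :: "(nat \<Rightarrow> 'g) \<Rightarrow> nat \<Rightarrow> nat \<Rightarrow> nat \<Rightarrow> 'g \<Rightarrow> (complex, 'n) sqmat exterior"
  where "slot_form i N q k = (if k = q then dual_form i N else curv i N)"

lemma scalar_form_slot_form: "scalar_form (slot_form i N q k a)"
  by (simp add: slot_form_def)

lemma slot_form_commute:
  assumes "p \<noteq> p'"
  shows "slot_form i N q p a * slot_form i N q p' b = slot_form i N q p' b * slot_form i N q p a"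
  by (rule scalar_form_commute) (use assms in \<open>auto simp: slot_form_def\<close>)

text \<open>\<open>D\<close> is left arbitrary so that each term of the symmetrisation, a d-tensor
  with permuted slots, can be inserted.\<close>

lemma alt_form_blocks:
  "alt_form i (Suc (2 * M)) (\<lambda>j. of_real (\<Sum>l\<in>multi_indices M.
      (\<Prod>k=1..M. C (j (2 * k - 1)) (j (2 * k)) (l k)) * D (l(Suc M := j (Suc (2 * M))))))
    = (\<Sum>l\<in>multi_indices (Suc M). oprod (\<lambda>k. slot_form i (Suc (2 * M)) (Suc M) k (l k)) (Suc M)
        * cform (of_real (D l)))"
proof -
  let ?N = "Suc (2 * M)"
  let ?\<theta> = "dual_form i ?N :: 'g \<Rightarrow> (complex, 'n) sqmat exterior"
  let ?O = "\<lambda>j. oprod (\<lambda>p. ?\<theta> (j p)) (2 * M)"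
  let ?P = "\<lambda>l j. \<Prod>k=1..M. complex_of_real (C (j (2 * k - 1)) (j (2 * k)) (l k))"
  have P: "?P l (j(?N := a)) = ?P l j" for l j a
    by (rule prod.cong) auto
  have S: "oprod (\<lambda>k. slot_form i ?N (Suc M) k ((l(Suc M := a)) k)) (Suc M)
      = oprod (\<lambda>k. curv i ?N (l k)) M * ?\<theta> a" for l a
  proof -
    have "oprod (\<lambda>k. slot_form i ?N (Suc M) k ((l(Suc M := a)) k)) M = oprod (\<lambda>k. curv i ?N (l k)) M"
      by (rule oprod_cong) (simp add: slot_form_def)
    then show ?thesis by (simp add: slot_form_def)
  qed
  have "alt_form i ?N (\<lambda>j. of_real (\<Sum>l\<in>multi_indices M.
      (\<Prod>k=1..M. C (j (2 * k - 1)) (j (2 * k)) (l k)) * D (l(Suc M := j ?N))))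
    = (\<Sum>j\<in>multi_indices (2 * M). \<Sum>a\<in>UNIV. ?O j * ?\<theta> a
        * cform (\<Sum>l\<in>multi_indices M. ?P l j * of_real (D (l(Suc M := a)))))"
    unfolding alt_form_Suc of_real_sum of_real_mult of_real_prod P fun_upd_same ..
  also have "\<dots> = (\<Sum>j\<in>multi_indices (2 * M). \<Sum>a\<in>UNIV. \<Sum>l\<in>multi_indices M.
      ?O j * cform (?P l j) * (?\<theta> a * cform (of_real (D (l(Suc M := a))))))"
  proof (intro sum.cong refl)
    fix j a
    have "?O j * ?\<theta> a * (cform p * cform c) = ?O j * cform p * (?\<theta> a * cform c)" for p c
      using cform_left_commute[of "?\<theta> a" p "cform c"] by (simp only: mult.assoc)
    then show "?O j * ?\<theta> a * cform (\<Sum>l\<in>multi_indices M. ?P l j * of_real (D (l(Suc M := a))))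
      = (\<Sum>l\<in>multi_indices M. ?O j * cform (?P l j) * (?\<theta> a * cform (of_real (D (l(Suc M := a))))))"
      by (simp only: cform_sum cform_mult sum_distrib_left)
  qed
  also have "\<dots> = (\<Sum>a\<in>UNIV. \<Sum>l\<in>multi_indices M. \<Sum>j\<in>multi_indices (2 * M).
      ?O j * cform (?P l j) * (?\<theta> a * cform (of_real (D (l(Suc M := a))))))"
    by (subst sum.swap) (rule sum.cong[OF refl], rule sum.swap)
  also have "\<dots> = (\<Sum>a\<in>UNIV. \<Sum>l\<in>multi_indices M.
      oprod (\<lambda>k. curv i ?N (l k)) M * (?\<theta> a * cform (of_real (D (l(Suc M := a))))))"
    by (simp only: sum_distrib_right[symmetric] oprod_curv)
  also have "\<dots> = (\<Sum>l\<in>multi_indices (Suc M). oprod (\<lambda>k. slot_form i ?N (Suc M) k (l k)) (Suc M)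
        * cform (of_real (D l)))"
    unfolding sum_multi_indices_Suc[of _ M] S mult.assoc by (rule sum.swap)
  finally show ?thesis .
qed

text \<open>The value is independent of \<open>\<sigma>\<close>, as a permutation of the slots only
  changes where the odd form enters the chain. Of the factor 2^M, the part 2^(M-1) comes from the
  anticommutators and the last 2 from the normalisation of the trace.\<close>

lemma alt_form_slot:
  assumes \<sigma>: "\<sigma> permutes {1..Suc M}" and "1 \<le> M"
  shows "alt_form i (Suc (2 * M)) (\<lambda>j. of_real (\<Sum>l\<in>multi_indices M.
      (\<Prod>k=1..M. C (j (2 * k - 1)) (j (2 * k)) (l k)) * d_tensor d (Suc M) (l(Suc M := j (Suc (2 * M))) \<circ> \<sigma>)))
    = cform (2 ^ M) * ftrace (vec_form (curv i (Suc (2 * M))) ^ M * theta i (Suc (2 * M)))"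
proof -
  let ?N = "Suc (2 * M)" and ?n = "Suc M"
  let ?s = "slot_form i ?N ?n" and ?q = "inv \<sigma> ?n"
  let ?P = "\<lambda>l. oprod (\<lambda>k. ?s k (l k)) ?n"
  have P: "?P (l \<circ> inv \<sigma>) = oprod (\<lambda>p. ?s (\<sigma> p) (l p)) ?n" for l
  proof -
    have comm: "?s p ((l \<circ> inv \<sigma>) p) * ?s p' ((l \<circ> inv \<sigma>) p') = ?s p' ((l \<circ> inv \<sigma>) p') * ?s p ((l \<circ> inv \<sigma>) p)" for p p'
      by (cases "p = p'") (simp, rule slot_form_commute)
    have "oprod ((\<lambda>k. ?s k ((l \<circ> inv \<sigma>) k)) \<circ> \<sigma>) ?n = ?P (l \<circ> inv \<sigma>)"
      using comm \<sigma> by (rule oprod_permutes_commute)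
    moreover have "(\<lambda>k. ?s k ((l \<circ> inv \<sigma>) k)) \<circ> \<sigma> = (\<lambda>p. ?s (\<sigma> p) (l p))"
      using permutes_inverses(2)[OF \<sigma>] by (simp add: fun_eq_iff)
    ultimately show ?thesis by (simp only:)
  qed
  have "l \<circ> \<sigma> \<circ> inv \<sigma> = l" for l :: "nat \<Rightarrow> 'g"
    using permutes_inv_o(1)[OF \<sigma>] by (simp only: o_assoc[symmetric] comp_id)
  \<comment> \<open>Inserting \<open>\<sigma> \<circ> inv \<sigma>\<close> transfers the permutation
    from the slots of the tensor to the forms.\<close>
  then have "(\<Sum>l\<in>multi_indices ?n. ?P l * cform (of_real (d_tensor d ?n (l \<circ> \<sigma>))))
      = (\<Sum>l\<in>multi_indices ?n. ?P (l \<circ> \<sigma> \<circ> inv \<sigma>) * cform (of_real (d_tensor d ?n (l \<circ> \<sigma>))))"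
    by (simp only:)
  also have "\<dots> = (\<Sum>l\<in>multi_indices ?n. ?P (l \<circ> inv \<sigma>) * cform (of_real (d_tensor d ?n l)))"
    by (rule sum_multi_indices_permute[OF \<sigma>])
  also have "\<dots> = cform 2 * ftrace (jordan_form (\<lambda>p. ?s (\<sigma> p)) M * vec_form (?s (\<sigma> ?n)))"
    unfolding P by (rule d_tensor_form_eq_ftrace) (rule scalar_form_slot_form)
  also have "ftrace (jordan_form (\<lambda>p. ?s (\<sigma> p)) M * vec_form (?s (\<sigma> ?n)))
      = cform (2 ^ (M - 1)) * ftrace (vec_form (curv i ?N) ^ M * theta i ?N)"
  proof (rule ftrace_jordan_chain[where q = ?q and V = "\<lambda>p. vec_form (?s (\<sigma> p))"
        and J = "jordan_form (\<lambda>p. ?s (\<sigma> p))" and r = M and c = "2 / of_nat CARD('n)"])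
    show "jordan_form (\<lambda>p. ?s (\<sigma> p)) 1 = vec_form (?s (\<sigma> 1))"
      by (rule jordan_form_1)
    show "jordan_form (\<lambda>p. ?s (\<sigma> p)) (Suc r)
        = jordan_form (\<lambda>p. ?s (\<sigma> p)) r * vec_form (?s (\<sigma> (Suc r)))
          + vec_form (?s (\<sigma> (Suc r))) * jordan_form (\<lambda>p. ?s (\<sigma> p)) r
          - cform (2 / of_nat CARD('n)) * ftrace (jordan_form (\<lambda>p. ?s (\<sigma> p)) r * vec_form (?s (\<sigma> (Suc r))))"
      if "1 \<le> r" for r
    proof (rule jordan_form_Suc[OF _ _ that])
      show "?s (\<sigma> p) a * ?s (\<sigma> p') b = ?s (\<sigma> p') b * ?s (\<sigma> p) a" if "p \<noteq> p'" for p p' a b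
        using that permutes_inj[OF \<sigma>] by (intro slot_form_commute) (auto dest: injD)
    qed (rule scalar_form_slot_form)
    show "vec_form (?s (\<sigma> p)) = vec_form (curv i ?N)" if "p \<noteq> ?q" for p
      using that permutes_inverses(2)[OF \<sigma>, of p] by (auto simp: slot_form_def)
    show "vec_form (?s (\<sigma> ?q)) = theta i ?N"
      using permutes_inverses(1)[OF \<sigma>, of ?n] by (simp add: slot_form_def theta_def)
    show "1 \<le> ?q" "?q \<le> Suc M"
      using permutes_in_image[OF permutes_inv[OF \<sigma>], of ?n] by simp_all
  qed (use \<open>1 \<le> M\<close> in \<open>simp_all only: ftrace_vec_form_curv_power homog_vec_form_curv theta_commute_curv\<close>)
  also have "cform 2 * (cform (2 ^ (M - 1)) * ftrace (vec_form (curv i ?N) ^ M * theta i ?N))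
      = cform (2 ^ M) * ftrace (vec_form (curv i ?N) ^ M * theta i ?N)"
    using \<open>1 \<le> M\<close> by (cases M) (simp_all add: mult.assoc flip: cform_mult mult.assoc)
  finally show ?thesis
    unfolding alt_form_blocks[where D = "\<lambda>l. d_tensor d ?n (l \<circ> \<sigma>)"] .
qed

lemma theta_power:
  "theta i N ^ n = (\<Sum>j\<in>multi_indices n. oprod (\<lambda>p. dual_form i N (j p)) n * const (oprod (\<lambda>p. gen (j p)) n))"
  unfolding theta_def vec_form_def oprod_const[symmetric] oprod_sum
proof (rule sum.cong[OF refl])
  fix j :: "nat \<Rightarrow> 'g"
  show "oprod (\<lambda>p. dual_form i N (j p) * const (gen (j p))) n
      = oprod (\<lambda>p. dual_form i N (j p)) n * const (oprod (\<lambda>p. gen (j p)) n)"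
    unfolding oprod_const_form[symmetric]
    by (rule oprod_mult) (simp add: const_scalar_form_commute)
qed

lemma alt_form_mtrace_oprod: "alt_form i N (\<lambda>j. mtrace (oprod (\<lambda>p. gen (j p)) N)) = ftrace (theta i N ^ N)"
proof -
  have "ftrace (oprod (\<lambda>p. dual_form i N (j p)) N * const A)
      = oprod (\<lambda>p. dual_form i N (j p)) N * cform (mtrace A)" for j and A :: "(complex, 'n) sqmat"
    by (subst ftrace_scalar_mult) (simp_all add: scalar_form_oprod ftrace_const)
  then show ?thesis
    by (simp only: alt_form_def theta_power ftrace_sum)
qed

text \<open>By \<open>alt_form_slot\<close> all (M+1)! terms of the symmetrisation agree, which
  cancels its weight. The d-tensor gives 2^M and the structure constants give (-2i)^M.\<close>

theorem Omega_eq_alternated_trace: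
  assumes "1 \<le> M"
  shows "complex_of_real (Omega C d (Suc M) i) = (- 4 * \<i>) ^ M / fact (Suc (2 * M)) *
    (\<Sum>j\<in>multi_indices (Suc (2 * M)).
      of_real (eps (Suc (2 * M)) i j) * mtrace (oprod (\<lambda>p. gen (j p)) (Suc (2 * M))))"
proof -
  let ?N = "Suc (2 * M)"
  let ?S = "{\<sigma>. \<sigma> permutes {1..Suc M}}"
  let ?P = "\<lambda>l j. \<Prod>k=1..M. C (j (2 * k - 1)) (j (2 * k)) (l k)"
  let ?g = "\<lambda>\<sigma> j. \<Sum>l\<in>multi_indices M. ?P l j * d_tensor d (Suc M) (l(Suc M := j ?N) \<circ> \<sigma>)"
  let ?G = "\<lambda>j. \<Sum>\<sigma>\<in>?S. complex_of_real (1 / fact (Suc M)) * of_real (?g \<sigma> j)"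
  have G: "?G j = of_real (\<Sum>l\<in>multi_indices M. ?P l j * sym_d_tensor d (Suc M) (l(Suc M := j ?N)))" for j
    unfolding sym_d_tensor_def of_real_mult[symmetric] of_real_sum[symmetric] of_real_eq_iff
      sum_distrib_left by (subst sum.swap) (simp only: mult.left_commute)
  have "alt_form i ?N ?G = cform (complex_of_real (1 / fact (Suc M))) * (\<Sum>\<sigma>\<in>?S. alt_form i ?N (\<lambda>j. of_real (?g \<sigma> j)))"
    by (rule alt_form_lincomb)
  also have "(\<Sum>\<sigma>\<in>?S. alt_form i ?N (\<lambda>j. of_real (?g \<sigma> j)))
      = (\<Sum>\<sigma>\<in>?S. cform (2 ^ M) * ftrace (vec_form (curv i ?N) ^ M * theta i ?N))"
    by (rule sum.cong[OF refl]) (rule alt_form_slot[OF _ assms], simp)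
  also have "\<dots> = cform (of_nat (card ?S)) * (cform (2 ^ M) * ftrace (vec_form (curv i ?N) ^ M * theta i ?N))"
  proof -
    have "(\<Sum>\<sigma>\<in>?S. cform 1 * X) = cform (of_nat (card ?S)) * X" for X :: "(complex, 'n) sqmat exterior"
      unfolding sum_distrib_right[symmetric] cform_sum[symmetric] by simp
    then show ?thesis by simp
  qed
  also have "vec_form (curv i ?N) ^ M * theta i ?N = cform ((- 2 * \<i>) ^ M) * theta i ?N ^ ?N"
    unfolding vec_form_curv_power power_Suc2 by (simp only: mult.assoc)
  also have "card ?S = fact (Suc M)"
    by (rule card_permutations) simp_all
  also have "cform (complex_of_real (1 / fact (Suc M))) * (cform (of_nat (fact (Suc M)))
        * (cform (2 ^ M) * ftrace (cform ((- 2 * \<i>) ^ M) * theta i ?N ^ ?N)))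
      = cform (1 / fact (Suc M) * fact (Suc M) * 2 ^ M * (- 2 * \<i>) ^ M) * ftrace (theta i ?N ^ ?N)"
    by (simp only: ftrace_cform_mult cform_mult mult.assoc of_nat_fact of_real_divide of_real_1 of_real_fact)
  also have "1 / fact (Suc M) * fact (Suc M) * 2 ^ M * (- 2 * \<i>) ^ M = (- 4 * \<i>) ^ M"
  proof -
    have "(2 * (- 2 * \<i>)) ^ M = (2 ^ M * (- 2 * \<i>) ^ M :: complex)" by (rule power_mult_distrib)
    then show ?thesis by (simp del: fact_Suc)
  qed
  finally have "(\<Sum>j\<in>multi_indices ?N. of_real (eps ?N i j) * ?G j)
      = (- 4 * \<i>) ^ M * (\<Sum>j\<in>multi_indices ?N. of_real (eps ?N i j) * mtrace (oprod (\<lambda>p. gen (j p)) ?N))"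
    unfolding alt_form_mtrace_oprod[symmetric] by (rule alt_form_eq_imp_sum_eq)
  moreover have "complex_of_real (Omega C d (Suc M) i)
      = 1 / fact ?N * (\<Sum>j\<in>multi_indices ?N. of_real (eps ?N i j) * ?G j)"
  proof -
    have N: "2 * Suc M - 1 = ?N" by simp
    have "Omega C d (Suc M) i = 1 / fact ?N * (\<Sum>j\<in>multi_indices ?N. eps ?N i j *
        (\<Sum>l\<in>multi_indices M. ?P l j * sym_d_tensor d (Suc M) (l(Suc M := j ?N))))"
      unfolding Omega_def N diff_Suc_1 sum_distrib_left mult.assoc ..
    then show ?thesis
      unfolding G by simp
  qed
  ultimately show ?thesis by simp
qed

section \<open>The recursion\<close>

text \<open>The trace part \<open>S\<close> stays anonymous because only its scalar coefficients
  matter: a later trace factors it out.\<close>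

lemma contraction_form:
  fixes i :: "nat \<Rightarrow> 'g" and N :: nat
  defines "\<theta> \<equiv> dual_form i N"
  obtains S where "scalar_form S"
    "(\<Sum>a\<in>UNIV. \<Sum>b\<in>UNIV. \<Sum>c\<in>UNIV. \<theta> a * \<theta> b * \<theta> c *
        const (\<Sum>l\<in>UNIV. scal (of_real (C a b l)) * (\<Sum>s\<in>UNIV. scal (of_real (d s l c)) * gen s)))
      = vec_form (curv i N) * theta i N + theta i N * vec_form (curv i N) - S"
proof -
  let ?S = "\<Sum>l\<in>UNIV. \<Sum>c\<in>UNIV. curv i N l * \<theta> c * cform (of_real (kdelta l c) / of_nat CARD('n))"
  let ?R = "\<lambda>l c. \<Sum>s\<in>UNIV. scal (of_real (d s l c)) * gen s"
  have R: "const (?R l c) = const (gen l * gen c) + const (gen c * gen l) - cform (of_real (kdelta l c) / of_nat CARD('n))"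
    for l c
    unfolding d_cyclic[of _ l c] gen_anticommutator const_diff const_add cform_def ..
  have "(\<Sum>a\<in>UNIV. \<Sum>b\<in>UNIV. \<Sum>c\<in>UNIV. \<theta> a * \<theta> b * \<theta> c * const (\<Sum>l\<in>UNIV. scal (of_real (C a b l)) * ?R l c))
      = (\<Sum>a\<in>UNIV. \<Sum>b\<in>UNIV. \<Sum>c\<in>UNIV. \<Sum>l\<in>UNIV. \<theta> a * \<theta> b * cform (of_real (C a b l)) * (\<theta> c * const (?R l c)))"
  proof (intro sum.cong refl)
    fix a b c
    have "\<theta> a * \<theta> b * \<theta> c * (cform x * Y) = \<theta> a * \<theta> b * cform x * (\<theta> c * Y)" for x Y
      using cform_left_commute[of "\<theta> c" x Y] by (simp only: mult.assoc)
    then show "\<theta> a * \<theta> b * \<theta> c * const (\<Sum>l\<in>UNIV. scal (of_real (C a b l)) * ?R l c)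
        = (\<Sum>l\<in>UNIV. \<theta> a * \<theta> b * cform (of_real (C a b l)) * (\<theta> c * const (?R l c)))"
      by (simp only: const_sum const_mult[of "scal _"] cform_def[symmetric] sum_distrib_left[of "_ * _ * _"])
  qed
  also have "\<dots> = (\<Sum>a\<in>UNIV. \<Sum>b\<in>UNIV. \<Sum>l\<in>UNIV. \<Sum>c\<in>UNIV. \<theta> a * \<theta> b * cform (of_real (C a b l)) * (\<theta> c * const (?R l c)))"
    by (rule sum.cong[OF refl], rule sum.cong[OF refl]) (rule sum.swap)
  also have "\<dots> = (\<Sum>a\<in>UNIV. \<Sum>l\<in>UNIV. \<Sum>b\<in>UNIV. \<Sum>c\<in>UNIV. \<theta> a * \<theta> b * cform (of_real (C a b l)) * (\<theta> c * const (?R l c)))"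
    by (rule sum.cong[OF refl]) (rule sum.swap)
  also have "\<dots> = (\<Sum>l\<in>UNIV. \<Sum>a\<in>UNIV. \<Sum>b\<in>UNIV. \<Sum>c\<in>UNIV. \<theta> a * \<theta> b * cform (of_real (C a b l)) * (\<theta> c * const (?R l c)))"
    by (rule sum.swap)
  also have "\<dots> = (\<Sum>l\<in>UNIV. \<Sum>c\<in>UNIV. curv i N l * (\<theta> c * const (?R l c)))"
    unfolding sum_distrib_left[symmetric] sum_distrib_right[symmetric] curv_def \<theta>_def ..
  also have "\<dots> = (\<Sum>l\<in>UNIV. \<Sum>c\<in>UNIV. curv i N l * \<theta> c * const (gen l * gen c)
      + curv i N l * \<theta> c * const (gen c * gen l)
      - curv i N l * \<theta> c * cform (of_real (kdelta l c) / of_nat CARD('n)))"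
    unfolding R by (simp only: distrib_left right_diff_distrib mult.assoc)
  also have "\<dots> = (\<Sum>l\<in>UNIV. \<Sum>c\<in>UNIV. curv i N l * \<theta> c * const (gen l * gen c))
      + (\<Sum>l\<in>UNIV. \<Sum>c\<in>UNIV. curv i N l * \<theta> c * const (gen c * gen l)) - ?S"
    by (simp only: sum.distrib sum_subtractf)
  also have "(\<Sum>l\<in>UNIV. \<Sum>c\<in>UNIV. curv i N l * \<theta> c * const (gen l * gen c)) = vec_form (curv i N) * theta i N"
    unfolding theta_def \<theta>_def by (rule vec_form_mult_vec_form[symmetric]) simp
  also have "(\<Sum>l\<in>UNIV. \<Sum>c\<in>UNIV. curv i N l * \<theta> c * const (gen c * gen l)) = theta i N * vec_form (curv i N)"
  proof -
    have "curv i N l * \<theta> c = \<theta> c * curv i N l" for l c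
      by (rule scalar_form_commute) simp_all
    then have "(\<Sum>l\<in>UNIV. \<Sum>c\<in>UNIV. curv i N l * \<theta> c * const (gen c * gen l))
        = (\<Sum>c\<in>UNIV. \<Sum>l\<in>UNIV. \<theta> c * curv i N l * const (gen c * gen l))"
      by (subst sum.swap) (simp only:)
    also have "\<dots> = theta i N * vec_form (curv i N)"
      unfolding theta_def \<theta>_def by (rule vec_form_mult_vec_form[symmetric]) simp
    finally show ?thesis .
  qed
  finally show ?thesis
  proof (rule that[rotated])
    show "scalar_form ?S"
      unfolding \<theta>_def by (intro scalar_form_sum scalar_form_mult) simp_all
  qed
qed

text \<open>One term of the right-hand side, with the previous cocycle expanded into traces and s in
  the last factor; \<open>n\<close> counts the generators in front of it.\<close>

definition contracted_trace :: "nat \<Rightarrow> (nat \<Rightarrow> 'g) \<Rightarrow> complex"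
  where "contracted_trace n j = (\<Sum>s\<in>UNIV. \<Sum>l\<in>UNIV. mtrace (oprod (\<lambda>p. gen ((j(Suc n := s)) p)) (Suc n))
    * of_real (C (j (Suc n)) (j (Suc (Suc n))) l * d s l (j (Suc (Suc (Suc n))))))"

lemma contracted_trace_eq_mtrace:
  "contracted_trace n j = mtrace (oprod (\<lambda>p. gen (j p)) n
    * (\<Sum>l\<in>UNIV. scal (of_real (C (j (Suc n)) (j (Suc (Suc n))) l))
        * (\<Sum>s\<in>UNIV. scal (of_real (d s l (j (Suc (Suc (Suc n)))))) * gen s)))"
proof -
  let ?G = "oprod (\<lambda>p. gen (j p)) n"
  have O: "oprod (\<lambda>p. gen ((j(Suc n := s)) p)) (Suc n) = ?G * gen s" for s
    by (simp only: oprod.simps oprod_upd[of "\<lambda>_. gen"] fun_upd_same)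
  have "mtrace (?G * (scal c * (scal e * gen s))) = mtrace (?G * gen s) * (c * e)" for c e s
    unfolding mult.assoc[symmetric] scal_mult[symmetric]
    by (simp add: mult.assoc mtrace_scal_mult mult.commute flip: scal_commute[of "c * e" ?G])
  then show ?thesis
    unfolding contracted_trace_def O of_real_mult sum_distrib_left mtrace_sum
    by (subst sum.swap) (simp only:)
qed

text \<open>The scalar part of the contraction contributes a multiple of the trace of
  \<open>theta\<close> to the power 2K, which vanishes since \<open>1 \<le> K\<close>.\<close>

lemma alt_form_contracted_trace:
  assumes "1 \<le> K"
  shows "alt_form i (Suc (Suc (Suc (2 * K)))) (contracted_trace (2 * K))
    = cform (- 4 * \<i>) * ftrace (theta i (Suc (Suc (Suc (2 * K)))) ^ Suc (Suc (Suc (2 * K))))"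
proof -
  let ?n = "2 * K"
  let ?N = "Suc (Suc (Suc ?n))"
  let ?\<theta> = "dual_form i ?N :: 'g \<Rightarrow> (complex, 'n) sqmat exterior" and ?F = "vec_form (curv i ?N)"
  let ?Q = "\<lambda>a b c. \<Sum>l\<in>UNIV. scal (of_real (C a b l)) * (\<Sum>s\<in>UNIV. scal (of_real (d s l c)) * gen s)"
  let ?O = "\<lambda>j. oprod (\<lambda>p. ?\<theta> (j p)) ?n" and ?G = "\<lambda>j. oprod (\<lambda>p. gen (j p)) ?n"
  let ?u = "\<lambda>j a b c. j(Suc ?n := a, Suc (Suc ?n) := b, Suc (Suc (Suc ?n)) := c)"
  have O: "oprod (\<lambda>p. ?\<theta> (?u j a b c p)) ?N = ?O j * (?\<theta> a * ?\<theta> b * ?\<theta> c)" for j a b c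
  proof -
    have "oprod (\<lambda>p. ?\<theta> (?u j a b c p)) ?n = ?O j"
      by (rule oprod_cong) simp
    then show ?thesis by (simp add: mult.assoc)
  qed
  have H: "contracted_trace ?n (?u j a b c) = mtrace (?G j * ?Q a b c)" for j a b c
  proof -
    have "oprod (\<lambda>p. gen (?u j a b c p)) ?n = ?G j"
      by (rule oprod_cong) simp
    then show ?thesis unfolding contracted_trace_eq_mtrace by simp
  qed
  have step: "?O j * (?\<theta> a * ?\<theta> b * ?\<theta> c) * cform (mtrace (?G j * ?Q a b c))
      = ftrace (?O j * const (?G j) * (?\<theta> a * ?\<theta> b * ?\<theta> c * const (?Q a b c)))" for j a b c
  proof -
    let ?t = "?\<theta> a * ?\<theta> b * ?\<theta> c"
    have t: "scalar_form ?t" by (intro scalar_form_mult) simp_all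
    have scalar: "scalar_form (?O j * ?t)"
      by (rule scalar_form_mult[OF scalar_form_oprod t]) (rule scalar_form_dual_form)
    have "?O j * const (?G j) * (?t * const (?Q a b c)) = ?O j * (const (?G j) * ?t) * const (?Q a b c)"
      by (simp only: mult.assoc)
    also have "\<dots> = ?O j * ?t * const (?G j * ?Q a b c)"
      unfolding const_scalar_form_commute[OF t] const_mult by (simp only: mult.assoc)
    finally show ?thesis by (simp only: ftrace_scalar_mult[OF scalar] ftrace_const)
  qed
  have "alt_form i ?N (contracted_trace ?n) = (\<Sum>j\<in>multi_indices ?n. \<Sum>a\<in>UNIV. \<Sum>b\<in>UNIV. \<Sum>c\<in>UNIV.
      oprod (\<lambda>p. ?\<theta> (?u j a b c p)) ?N * cform (contracted_trace ?n (?u j a b c)))"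
    unfolding alt_form_def sum_multi_indices_Suc ..
  also have "\<dots> = (\<Sum>j\<in>multi_indices ?n. \<Sum>a\<in>UNIV. \<Sum>b\<in>UNIV. \<Sum>c\<in>UNIV.
      ftrace (?O j * const (?G j) * (?\<theta> a * ?\<theta> b * ?\<theta> c * const (?Q a b c))))"
  proof (rule sum.cong[OF refl], rule sum.cong[OF refl], rule sum.cong[OF refl], rule sum.cong[OF refl])
    fix j :: "nat \<Rightarrow> 'g" and a b c
    show "oprod (\<lambda>p. ?\<theta> (?u j a b c p)) ?N * cform (contracted_trace ?n (?u j a b c))
        = ftrace (?O j * const (?G j) * (?\<theta> a * ?\<theta> b * ?\<theta> c * const (?Q a b c)))"
      unfolding O H by (rule step)
  qed
  also have "\<dots> = ftrace (theta i ?N ^ ?n * (\<Sum>a\<in>UNIV. \<Sum>b\<in>UNIV. \<Sum>c\<in>UNIV. ?\<theta> a * ?\<theta> b * ?\<theta> c * const (?Q a b c)))"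
    by (simp only: theta_power sum_distrib_left[symmetric] sum_distrib_right[symmetric] ftrace_sum[symmetric])
  also have "\<dots> = ftrace (theta i ?N ^ ?n * (?F * theta i ?N + theta i ?N * ?F))"
  proof -
    obtain S where S: "scalar_form S" and eq: "(\<Sum>a\<in>UNIV. \<Sum>b\<in>UNIV. \<Sum>c\<in>UNIV. ?\<theta> a * ?\<theta> b * ?\<theta> c * const (?Q a b c))
        = ?F * theta i ?N + theta i ?N * ?F - S"
      by (rule contraction_form[of i ?N])
    have "theta i ?N ^ ?n * S = S * theta i ?N ^ ?n"
      using S homog_power_even[OF homog_theta_sq, of i ?N K] unfolding theta_even_power
      by (intro scalar_form_commute[symmetric]) simp_all
    then have "ftrace (theta i ?N ^ ?n * S) = 0"
      using ftrace_scalar_mult[OF S] ftrace_theta_even_power[OF assms] by simp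
    then show ?thesis
      unfolding eq right_diff_distrib ftrace_diff by simp
  qed
  also have "theta i ?N ^ ?n * (?F * theta i ?N + theta i ?N * ?F) = cform (- 4 * \<i>) * theta i ?N ^ ?N"
  proof -
    let ?t = "theta i ?N"
    have "?F * ?t = cform (- 2 * \<i>) * (?t * ?t * ?t)"
      unfolding vec_form_curv by (simp only: mult.assoc)
    then have "?F * ?t + ?t * ?F = cform (- 4 * \<i>) * (?t * ?t * ?t)"
      unfolding theta_commute_curv by (simp flip: distrib_right cform_add)
    then have "?t ^ ?n * (?F * ?t + ?t * ?F) = cform (- 4 * \<i>) * (?t ^ ?n * (?t * ?t * ?t))"
      by (simp only: cform_left_commute[of "?t ^ ?n"])
    also have "?t ^ ?n * (?t * ?t * ?t) = ?t ^ ?N"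
      by (simp only: power_Suc2 mult.assoc)
    finally show ?thesis .
  qed
  finally show ?thesis by (simp only: ftrace_cform_mult)
qed

lemma contracted_trace_local:
  assumes "\<And>p. 1 \<le> p \<Longrightarrow> p \<le> Suc (Suc (Suc n)) \<Longrightarrow> j p = j' p"
  shows "contracted_trace n j = contracted_trace n j'"
proof -
  have "oprod (\<lambda>p. gen (j p)) n = oprod (\<lambda>p. gen (j' p)) n"
    by (rule oprod_cong) (simp add: assms)
  then show ?thesis
    unfolding contracted_trace_eq_mtrace by (simp add: assms)
qed

text \<open>\<open>cyclic_reduction\<close> trades \<open>\<sigma>\<close>, which may move the place
  of s, for a permutation of the 2K alternated places with the same sign;
  \<open>sum_eps_permute\<close> absorbs the latter.\<close>

lemma sum_eps_contracted_trace_permuted: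
  assumes "\<sigma> permutes {1..Suc (2 * K)}"
  shows "(\<Sum>j\<in>multi_indices (Suc (Suc (Suc (2 * K)))). of_real (eps (Suc (Suc (Suc (2 * K)))) i j) *
      (\<Sum>s\<in>UNIV. \<Sum>l\<in>UNIV. mtrace (oprod (\<lambda>p. gen ((j(Suc (2 * K) := s)) (\<sigma> p))) (Suc (2 * K)))
        * of_real (C (j (Suc (2 * K))) (j (Suc (Suc (2 * K)))) l * d s l (j (Suc (Suc (Suc (2 * K))))))))
    = of_int (sign \<sigma>) * (\<Sum>j\<in>multi_indices (Suc (Suc (Suc (2 * K)))).
        of_real (eps (Suc (Suc (Suc (2 * K)))) i j) * contracted_trace (2 * K) j)"
proof -
  let ?n = "2 * K"
  let ?N = "Suc (Suc (Suc ?n))"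
  obtain \<tau> where \<tau>: "\<tau> permutes {1..?n}" "sign \<tau> = sign \<sigma>"
    and tr: "\<And>g :: nat \<Rightarrow> (complex, 'n) sqmat.
      mtrace (oprod (g \<circ> \<sigma>) (Suc ?n)) = mtrace (oprod (g \<circ> \<tau>) (Suc ?n))"
    using cyclic_reduction[OF assms] by metis
  \<comment> \<open>Position 2K + 1 has two roles: inside the trace it is overwritten by s, while
    \<open>C\<close> reads the alternated index there. As \<open>\<tau>\<close> fixes all positions
    beyond 2K, it disturbs neither.\<close>
  have fixed: "\<tau> p = p" if "?n < p" for p
    using permutes_not_in[OF \<tau>(1)] that by simp
  have less: "\<tau> p \<noteq> Suc ?n" if "p \<noteq> Suc ?n" for p
    using permutes_inj[OF \<tau>(1)] fixed[of "Suc ?n"] that by (metis injD lessI)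
  have "mtrace (oprod (\<lambda>p. gen ((j(Suc ?n := s)) (\<sigma> p))) (Suc ?n))
      = mtrace (oprod (\<lambda>p. gen (((j \<circ> \<tau>)(Suc ?n := s)) p)) (Suc ?n))" for j s
  proof -
    have "(\<lambda>p. gen ((j(Suc ?n := s)) p)) \<circ> \<tau> = (\<lambda>p. gen (((j \<circ> \<tau>)(Suc ?n := s)) p))"
      using fixed[of "Suc ?n"] less by (auto simp: fun_eq_iff)
    then show ?thesis
      using tr[of "\<lambda>p. gen ((j(Suc ?n := s)) p)"] by (simp only: o_def)
  qed
  then have "(\<Sum>s\<in>UNIV. \<Sum>l\<in>UNIV. mtrace (oprod (\<lambda>p. gen ((j(Suc ?n := s)) (\<sigma> p))) (Suc ?n))
        * of_real (C (j (Suc ?n)) (j (Suc (Suc ?n))) l * d s l (j (Suc (Suc (Suc ?n))))))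
      = contracted_trace ?n (j \<circ> \<tau>)" for j
    unfolding contracted_trace_def by (simp only: o_apply fixed less_Suc_eq lessI simp_thms)
  moreover have "\<tau> permutes {1..?N}"
    using \<tau>(1) by (rule permutes_subset) auto
  then have "(\<Sum>j\<in>multi_indices ?N. of_real (eps ?N i j) * contracted_trace ?n (j \<circ> \<tau>))
      = of_int (sign \<tau>) * (\<Sum>j\<in>multi_indices ?N. of_real (eps ?N i j) * contracted_trace ?n j)"
    by (rule sum_eps_permute[rotated]) (rule contracted_trace_local)
  ultimately show ?thesis by (simp only: \<tau>(2))
qed

text \<open>In this form the place of each index inside the traces is explicit, which allows one
  index to be contracted instead of alternated.\<close>

lemma Omega_eq_permutation_sum:
  assumes "1 \<le> M"
  shows "complex_of_real (Omega C d (Suc M) i) = (- 4 * \<i>) ^ M / fact (Suc (2 * M)) *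
    (\<Sum>\<sigma> | \<sigma> permutes {1..Suc (2 * M)}.
      of_int (sign \<sigma>) * mtrace (oprod (\<lambda>p. gen (i (\<sigma> p))) (Suc (2 * M))))"
proof -
  let ?N = "Suc (2 * M)"
  have "(\<Sum>j\<in>multi_indices ?N. of_real (eps ?N i j) * mtrace (oprod (\<lambda>p. gen (j p)) ?N))
      = (\<Sum>\<sigma> | \<sigma> permutes {1..?N}. of_int (sign \<sigma>) * mtrace (oprod (\<lambda>p. gen ((i \<circ> \<sigma>) p)) ?N))"
  proof (rule sum_eps)
    fix j j' :: "nat \<Rightarrow> 'g" assume "\<And>p. 1 \<le> p \<Longrightarrow> p \<le> ?N \<Longrightarrow> j p = j' p"
    then show "mtrace (oprod (\<lambda>p. gen (j p)) ?N) = mtrace (oprod (\<lambda>p. gen (j' p)) ?N)"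
      by (intro arg_cong[of _ _ mtrace] oprod_cong) simp
  qed
  then show ?thesis
    unfolding Omega_eq_alternated_trace[OF assms] o_apply by (rule arg_cong)
qed

text \<open>The (2K+1)! permutations of the previous cocycle contribute equally and cancel its
  factorial; its constant (-4i)^K gains the factor -4i of the contraction.\<close>

lemma sum_eps_Omega_contraction:
  assumes "1 \<le> K"
  shows "(\<Sum>j\<in>multi_indices (Suc (Suc (Suc (2 * K)))). of_real (eps (Suc (Suc (Suc (2 * K)))) i j) *
      (\<Sum>s\<in>UNIV. \<Sum>l\<in>UNIV. of_real (Omega C d (Suc K) (j(Suc (2 * K) := s)))
        * of_real (C (j (Suc (2 * K))) (j (Suc (Suc (2 * K)))) l * d s l (j (Suc (Suc (Suc (2 * K))))))))
    = (- 4 * \<i>) ^ Suc K * (\<Sum>j\<in>multi_indices (Suc (Suc (Suc (2 * K)))).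
        of_real (eps (Suc (Suc (Suc (2 * K)))) i j)
        * mtrace (oprod (\<lambda>p. gen (j p)) (Suc (Suc (Suc (2 * K))))))"
proof -
  let ?n = "Suc (2 * K)"
  let ?N = "Suc (Suc ?n)"
  let ?S = "{\<sigma>. \<sigma> permutes {1..?n}}"
  let ?X = "\<lambda>j s l. complex_of_real (C (j ?n) (j (Suc ?n)) l * d s l (j ?N))"
  let ?tr = "\<lambda>\<sigma> j s. mtrace (oprod (\<lambda>p. gen ((j(?n := s)) (\<sigma> p))) ?n)"
  let ?h = "\<lambda>\<sigma> j. \<Sum>s\<in>UNIV. \<Sum>l\<in>UNIV. ?tr \<sigma> j s * ?X j s l"
  let ?e = "\<lambda>j. complex_of_real (eps ?N i j)"
  let ?k = "(- 4 * \<i>) ^ K / fact ?n"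
  have "(\<Sum>s\<in>UNIV. \<Sum>l\<in>UNIV. of_real (Omega C d (Suc K) (j(?n := s))) * ?X j s l)
      = ?k * (\<Sum>\<sigma>\<in>?S. of_int (sign \<sigma>) * ?h \<sigma> j)" for j
  proof -
    have "(\<Sum>s\<in>UNIV. \<Sum>l\<in>UNIV. of_real (Omega C d (Suc K) (j(?n := s))) * ?X j s l)
        = (\<Sum>s\<in>UNIV. \<Sum>l\<in>UNIV. \<Sum>\<sigma>\<in>?S. ?k * (of_int (sign \<sigma>) * (?tr \<sigma> j s * ?X j s l)))"
      unfolding Omega_eq_permutation_sum[OF assms] sum_distrib_left sum_distrib_right mult.assoc ..
    also have "\<dots> = (\<Sum>s\<in>UNIV. \<Sum>\<sigma>\<in>?S. \<Sum>l\<in>UNIV. ?k * (of_int (sign \<sigma>) * (?tr \<sigma> j s * ?X j s l)))"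
      by (rule sum.cong[OF refl]) (rule sum.swap)
    also have "\<dots> = (\<Sum>\<sigma>\<in>?S. \<Sum>s\<in>UNIV. \<Sum>l\<in>UNIV. ?k * (of_int (sign \<sigma>) * (?tr \<sigma> j s * ?X j s l)))"
      by (rule sum.swap)
    finally show ?thesis
      by (simp only: sum_distrib_left)
  qed
  then have "(\<Sum>j\<in>multi_indices ?N. ?e j * (\<Sum>s\<in>UNIV. \<Sum>l\<in>UNIV. of_real (Omega C d (Suc K) (j(?n := s))) * ?X j s l))
      = (\<Sum>j\<in>multi_indices ?N. \<Sum>\<sigma>\<in>?S. ?k * (of_int (sign \<sigma>) * (?e j * ?h \<sigma> j)))"
    by (simp only: sum_distrib_left[of _ _ ?S] mult.left_commute)
  also have "\<dots> = ?k * (\<Sum>\<sigma>\<in>?S. of_int (sign \<sigma>) * (\<Sum>j\<in>multi_indices ?N. ?e j * ?h \<sigma> j))"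
    unfolding sum_distrib_left[of _ _ ?S] sum_distrib_left[of _ _ "multi_indices ?N"] by (rule sum.swap)
  also have "(\<Sum>\<sigma>\<in>?S. of_int (sign \<sigma>) * (\<Sum>j\<in>multi_indices ?N. ?e j * ?h \<sigma> j))
      = (\<Sum>\<sigma>\<in>?S. \<Sum>j\<in>multi_indices ?N. ?e j * contracted_trace (2 * K) j)"
  proof (rule sum.cong[OF refl])
    fix \<sigma> assume "\<sigma> \<in> ?S"
    then have "(\<Sum>j\<in>multi_indices ?N. ?e j * ?h \<sigma> j)
        = of_int (sign \<sigma>) * (\<Sum>j\<in>multi_indices ?N. ?e j * contracted_trace (2 * K) j)"
      by (intro sum_eps_contracted_trace_permuted) simp
    \<comment> \<open>The sign from the expansion of the cocycle meets the one from the cyclic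
      reduction; their product is 1.\<close>
    then show "of_int (sign \<sigma>) * (\<Sum>j\<in>multi_indices ?N. ?e j * ?h \<sigma> j)
        = (\<Sum>j\<in>multi_indices ?N. ?e j * contracted_trace (2 * K) j)"
      by (simp only: mult.assoc[symmetric] of_int_mult[symmetric] sign_idempotent of_int_1 mult_1_left)
  qed
  also have "\<dots> = fact ?n * (\<Sum>j\<in>multi_indices ?N. ?e j * contracted_trace (2 * K) j)"
    unfolding sum_constant by (subst card_permutations[of _ ?n]) (simp_all del: fact_Suc)
  also have "(\<Sum>j\<in>multi_indices ?N. ?e j * contracted_trace (2 * K) j)
      = (- 4 * \<i>) * (\<Sum>j\<in>multi_indices ?N. ?e j * mtrace (oprod (\<lambda>p. gen (j p)) ?N))"
    using alt_form_contracted_trace[OF assms, of i] unfolding alt_form_mtrace_oprod[symmetric]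
    by (rule alt_form_eq_imp_sum_eq)
  finally have "(\<Sum>j\<in>multi_indices ?N. ?e j * (\<Sum>s\<in>UNIV. \<Sum>l\<in>UNIV. of_real (Omega C d (Suc K) (j(?n := s))) * ?X j s l))
      = ?k * (fact ?n * ((- 4 * \<i>) * (\<Sum>j\<in>multi_indices ?N. ?e j * mtrace (oprod (\<lambda>p. gen (j p)) ?N))))" .
  moreover have "a ^ K / fact ?n * (fact ?n * (a * x)) = a ^ Suc K * x" for a x :: complex
    by (simp del: fact_Suc)
  ultimately show ?thesis by (rule trans)
qed

text \<open>Both sides are (-4i)^(K+1) / (2K+3)! times the same alternated trace. The comparison
  takes place in the complex numbers and descends by injectivity of \<open>of_real\<close>.\<close>

lemma Omega_recursion:
  assumes "1 \<le> K"
  shows "Omega C d (Suc (Suc K)) i = 1 / fact (Suc (Suc (Suc (2 * K)))) *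
    (\<Sum>j\<in>multi_indices (Suc (Suc (Suc (2 * K)))). \<Sum>s\<in>UNIV. \<Sum>l\<in>UNIV.
      eps (Suc (Suc (Suc (2 * K)))) i j * Omega C d (Suc K) (j(Suc (2 * K) := s))
      * C (j (Suc (2 * K))) (j (Suc (Suc (2 * K)))) l * d s l (j (Suc (Suc (Suc (2 * K))))))"
    (is "_ = 1 / fact ?N * ?R")
proof -
  have "complex_of_real ?R = (- 4 * \<i>) ^ Suc K * (\<Sum>j\<in>multi_indices ?N.
      of_real (eps ?N i j) * mtrace (oprod (\<lambda>p. gen (j p)) ?N))"
    unfolding sum_eps_Omega_contraction[OF assms, symmetric]
    by (simp only: of_real_sum of_real_mult sum_distrib_left mult.assoc)
  then have "complex_of_real (Omega C d (Suc (Suc K)) i) = of_real (1 / fact ?N * ?R)"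
    using Omega_eq_alternated_trace[of "Suc K" i] by (simp del: fact_Suc)
  then show ?thesis
    by (simp only: of_real_eq_iff)
qed

end

theorem lemma7p1:
  fixes T :: "'g::finite \<Rightarrow> complex^'n^'n"
    and f d C :: "'g \<Rightarrow> 'g \<Rightarrow> 'g \<Rightarrow> real"
    and m :: nat
    and i :: "nat \<Rightarrow> 'g"
  assumes "su_generators T f d C"
    and "3 \<le> CARD('n)"
    and "3 \<le> m" and "m \<le> CARD('n)"
  shows "Omega C d m i =
    1 / fact (2 * m - 1) *
      (\<Sum>j\<in>multi_indices (2 * m - 1). \<Sum>s\<in>UNIV. \<Sum>l\<in>UNIV.
         eps (2 * m - 1) i j
         * Omega C d (m - 1) (j(2 * m - 3 := s))
         * C (j (2 * m - 3)) (j (2 * m - 2)) l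
         * d s l (j (2 * m - 1)))"
proof -
  \<comment> \<open>With m = K + 2 the truncated differences become successors, and
    \<open>3 \<le> m\<close> becomes \<open>1 \<le> K\<close>.\<close>
  define K where "K = m - 2"
  have m: "m = Suc (Suc K)" and "1 \<le> K"
    using \<open>3 \<le> m\<close> by (simp_all add: K_def)
  have "2 * m - 1 = Suc (Suc (Suc (2 * K)))" "2 * m - 2 = Suc (Suc (2 * K))"
    "2 * m - 3 = Suc (2 * K)" "m - 1 = Suc K"
    by (simp_all add: m)
  then show ?thesis
    using su_generators.Omega_recursion[OF assms(1) \<open>1 \<le> K\<close>, of i] by (simp only: m)
qed

end
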